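(* For every constant $p\in(0,1)$ there exist constants $c,C>0$ and $H_0\in\mathbb{N}$ (depending only on $p$) such that for every integer $H\ge H_0$ there exist: a layered state space $\mathcal{X}=\bigsqcup_{h=1}^H\mathcal{X}_h$ with $|\mathcal{X}|\le 2^{C\sqrt H}$; a policy class $\Pi$ of size $|\Pi|=2^{\lfloor\sqrt H\rfloor}$; a family $\mathcal{M}$ of MDPs with state space $\mathcal{X}$, binary action space $\mathcal{A}=\{0,1\}$ and horizon $H$; and a reset distribution $\mu=\{\mu_h\}_{h=1}^H$, known to the learner; such that every $M\in\mathcal{M}$ satisfies (i) $\Pi$ is realizable for $M$, and (ii) $\mu$ satisfies $C_{\mathsf{push}}(\mu;M)\le 8$; and moreover the following lower bound holds. Any proper deterministic algorithm that interacts through $\mu$-resets and that, for every $M\in\mathcal{M}$, returns with probability at least $p$ a $1/8$-optimal policy for $M$ must sample at least $2^{c\sqrt H}$ trajectories for some MDP in $\mathcal{M}$.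
   Context: **MDPs.** An episodic finite-horizon MDP is $M=(\mathcal{X},\mathcal{A},H,P,R,d_1)$ with finite layered state space $\mathcal{X}=\bigsqcup_{h=1}^H\mathcal{X}_h$, finite action set $\mathcal{A}$, horizon $H$, transition function $P$ (for $x\in\mathcal{X}_h$ with $h<H$ and $a\in\mathcal{A}$, $P(\cdot\mid x,a)$ is a probability distribution on $\mathcal{X}_{h+1}$), (possibly stochastic) rewards $r_h\sim R(x_h,a_h)$, and initial state distribution $d_1\in\Delta(\mathcal{X}_1)$. The cumulative reward of every trajectory (including trajectories started at a later layer) lies in $[0,1]$. A (Markov) policy is a map $\pi:\mathcal{X}\to\mathcal{A}$, with $\pi_h$ its restriction to $\mathcal{X}_h$. For $x\in\mathcal{X}_h$, $V_h^\pi(x)$ is the expected sum of rewards $r_h+\dots+r_H$ when starting at $x$ in layer $h$ and following $\pi$; $V^\pi=\mathbb{E}_{x\sim d_1}[V_1^\pi(x)]$. **Realizability.** $\Pi$ is realizable for $M$ if it contains an optimal policy $\pi^\star$ of $M$, i.e. some $\pi^\star\in\Pi$ with $V_h^{\pi^\star}(x)=\max_\pi V_h^\pi(x)$ for all $h\in[H]$, $x\in\mathcal{X}_h$ (the maximum being over all policies). A policy $\widehat\pi$ is $\varepsilon$-optimal if $V^{\widehat\pi}\ge\max_{\pi\in\Pi}V^\pi-\varepsilon$. **$\mu$-resets.** A reset distribution is $\mu=\{\mu_h\}_{h=1}^H$ with $\mu_h\in\Delta(\mathcal{X}_h)$, and it is assumed that $\mu_1=d_1$. In every round of interaction the learner picks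 a reset layer $h\in[H]$; a state $x_h\sim\mu_h$ is drawn and the learner rolls out a trajectory from $x_h$ to the end of the horizon, choosing the actions $a_h,\dots,a_H$ and observing the states and rewards. Each round counts as one sampled trajectory. The MDP in $\mathcal{M}$ is unknown to the learner; $\mathcal{X},\mathcal{A},H,\Pi,\mathcal{M},\mu$ are known. An algorithm is deterministic if its reset layers, actions, stopping decision and output are deterministic functions of past observations; it is proper if the returned policy belongs to $\Pi$. "Probability" is over the randomness of the interaction with the MDP. **Pushforward concentrability.** $$C_{\mathsf{push}}(\mu;M):=\max_{h\in[H-1]}\max_{x\in\mathcal{X}_h,\,a\in\mathcal{A}}\left\|\frac{P(\cdot\mid x,a)}{\mu_{h+1}}\right\|_\infty,$$ where $\|\nu/\mu_{h+1}\|_\infty$ is the smallest $B\in[0,\infty]$ with $\nu(x')\le B\mu_{h+1}(x')$ for all $x'\in\mathcal{X}_{h+1}$ (convention $1/0=\infty$). *)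

theory Defs
  imports "HOL-Probability.Probability"
begin

text \<open>
  The state space is a carrier inside the type \<open>'s\<close>, split into layers
  \<open>layer M 1, \<dots>, layer M (horizon M)\<close>; the action space is the whole finite type \<open>'a\<close>.
  Values of the fields outside the carrier (and of \<open>transition\<close> on the last layer) carry no meaning.
\<close>

record ('s, 'a) mdp =
  layer :: "nat \<Rightarrow> 's set"
  horizon :: nat
  transition :: "'s \<Rightarrow> 'a \<Rightarrow> 's pmf"
  reward :: "'s \<Rightarrow> 'a \<Rightarrow> real pmf"
  init :: "'s pmf"

type_synonym ('s, 'a) trajectory = "('s \<times> 'a \<times> real) list"

definition total_states :: "nat \<Rightarrow> (nat \<Rightarrow> 's set) \<Rightarrow> 's set" where
  "total_states H X = (\<Union>h\<in>{1..H}. X h)"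

definition layered :: "nat \<Rightarrow> (nat \<Rightarrow> 's set) \<Rightarrow> bool" where
  "layered H X \<longleftrightarrow> (\<forall>h\<in>{1..H}. finite (X h)) \<and> disjoint_family_on X {1..H}"

definition cumulative_reward :: "('s, 'a) trajectory \<Rightarrow> real" where
  "cumulative_reward \<tau> = (\<Sum>(x, a, r)\<leftarrow>\<tau>. r)"

text \<open>Trajectories from layer \<open>h\<close> to the end of the horizon, with arbitrary actions, all of whose
  rewards and transitions have positive probability.\<close>

definition trajectories_from :: "('s, 'a) mdp \<Rightarrow> nat \<Rightarrow> ('s, 'a) trajectory set" where
  "trajectories_from M h = {\<tau>. length \<tau> = Suc (horizon M) - h \<and>
     (\<forall>i < length \<tau>. case \<tau> ! i of (x, a, r) \<Rightarrow>
        x \<in> layer M (h + i) \<and> r \<in> set_pmf (reward M x a) \<and>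
        (Suc i < length \<tau> \<longrightarrow> fst (\<tau> ! Suc i) \<in> set_pmf (transition M x a)))}"

definition is_mdp :: "('s, 'a::finite) mdp \<Rightarrow> bool" where
  "is_mdp M \<longleftrightarrow>
     horizon M \<ge> 1 \<and>
     layered (horizon M) (layer M) \<and>
     set_pmf (init M) \<subseteq> layer M 1 \<and>
     (\<forall>h\<in>{1..<horizon M}. \<forall>x\<in>layer M h. \<forall>a.
        set_pmf (transition M x a) \<subseteq> layer M (Suc h)) \<and>
     (\<forall>h\<in>{1..horizon M}. \<forall>\<tau>\<in>trajectories_from M h. cumulative_reward \<tau> \<in> {0..1})"

text \<open>Policies are extensional functions, so that the cardinality of a policy class counts
  policies that differ on the state space.\<close>

definition policies :: "nat \<Rightarrow> (nat \<Rightarrow> 's set) \<Rightarrow> ('s \<Rightarrow> 'a) set" where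
  "policies H X = total_states H X \<rightarrow>\<^sub>E UNIV"

text \<open>
  \<open>rollout M f n \<tau> x\<close> extends the partial trajectory \<open>\<tau>\<close> by \<open>n\<close> further steps, the first one
  from state \<open>x\<close>, where \<open>f\<close> chooses each action from the current partial trajectory and the
  current state. The successor state drawn in the last step is discarded.
\<close>

primrec rollout ::
  "('s, 'a) mdp \<Rightarrow> (('s, 'a) trajectory \<Rightarrow> 's \<Rightarrow> 'a) \<Rightarrow> nat \<Rightarrow> ('s, 'a) trajectory \<Rightarrow> 's \<Rightarrow>
   ('s, 'a) trajectory pmf" where
  "rollout M f 0 \<tau> x = return_pmf \<tau>"
| "rollout M f (Suc n) \<tau> x =
     bind_pmf (reward M x (f \<tau> x)) (\<lambda>r.
     bind_pmf (transition M x (f \<tau> x)) (\<lambda>x'.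
     rollout M f n (\<tau> @ [(x, f \<tau> x, r)]) x'))"

definition rollout_from ::
  "('s, 'a) mdp \<Rightarrow> (('s, 'a) trajectory \<Rightarrow> 's \<Rightarrow> 'a) \<Rightarrow> nat \<Rightarrow> 's \<Rightarrow> ('s, 'a) trajectory pmf" where
  "rollout_from M f h x = rollout M f (Suc (horizon M) - h) [] x"

definition state_value :: "('s, 'a) mdp \<Rightarrow> ('s \<Rightarrow> 'a) \<Rightarrow> nat \<Rightarrow> 's \<Rightarrow> real" where
  "state_value M \<pi> h x =
     measure_pmf.expectation (rollout_from M (\<lambda>_. \<pi>) h x) cumulative_reward"

definition policy_value :: "('s, 'a) mdp \<Rightarrow> ('s \<Rightarrow> 'a) \<Rightarrow> real" where
  "policy_value M \<pi> = measure_pmf.expectation (init M) (state_value M \<pi> 1)"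

definition realizable :: "('s \<Rightarrow> 'a) set \<Rightarrow> ('s, 'a) mdp \<Rightarrow> bool" where
  "realizable Pol M \<longleftrightarrow>
     (\<exists>\<pi>\<in>Pol. \<forall>h\<in>{1..horizon M}. \<forall>x\<in>layer M h.
        state_value M \<pi> h x =
          Max ((\<lambda>\<pi>'. state_value M \<pi>' h x) ` policies (horizon M) (layer M)))"

definition eps_optimal :: "('s \<Rightarrow> 'a) set \<Rightarrow> ('s, 'a) mdp \<Rightarrow> real \<Rightarrow> ('s \<Rightarrow> 'a) \<Rightarrow> bool" where
  "eps_optimal Pol M \<epsilon> \<pi> \<longleftrightarrow> policy_value M \<pi> \<ge> Max (policy_value M ` Pol) - \<epsilon>"

definition is_reset_dist :: "nat \<Rightarrow> (nat \<Rightarrow> 's set) \<Rightarrow> (nat \<Rightarrow> 's pmf) \<Rightarrow> bool" where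
  "is_reset_dist H X \<mu> \<longleftrightarrow> (\<forall>h\<in>{1..H}. set_pmf (\<mu> h) \<subseteq> X h)"

text \<open>Since \<open>\<infinity> * 0 = 0\<close> on \<^typ>\<open>ennreal\<close>, the set below is empty, and the ratio \<open>\<infinity>\<close>, as soon as
  \<open>\<nu>\<close> charges a point of \<open>S\<close> that \<open>\<mu>\<close> does not.\<close>

definition linf_ratio :: "'s set \<Rightarrow> 's pmf \<Rightarrow> 's pmf \<Rightarrow> ennreal" where
  "linf_ratio S \<nu> \<mu> = Inf {B. \<forall>x\<in>S. ennreal (pmf \<nu> x) \<le> B * ennreal (pmf \<mu> x)}"

definition C_push :: "(nat \<Rightarrow> 's pmf) \<Rightarrow> ('s, 'a) mdp \<Rightarrow> ennreal" where
  "C_push \<mu> M =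
     (\<Squnion>h\<in>{1..<horizon M}. \<Squnion>x\<in>layer M h. \<Squnion>a.
        linf_ratio (layer M (Suc h)) (transition M x a) (\<mu> (Suc h)))"

text \<open>
  A deterministic algorithm maps the list of trajectories observed so far to its next move: stop
  and return a policy, or reset to a layer and roll out, choosing each action of the new trajectory
  from its observed part and the current state (and, through the move, from all
  earlier trajectories).
\<close>

datatype ('s, 'a) move =
    Stop "'s \<Rightarrow> 'a"
  | Reset nat "('s, 'a) trajectory \<Rightarrow> 's \<Rightarrow> 'a"

type_synonym ('s, 'a) algorithm = "('s, 'a) trajectory list \<Rightarrow> ('s, 'a) move"

definition is_algorithm :: "nat \<Rightarrow> ('s, 'a) algorithm \<Rightarrow> bool" where
  "is_algorithm H alg \<longleftrightarrow> (\<forall>hist h f. alg hist = Reset h f \<longrightarrow> h \<in> {1..H})"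

definition proper :: "('s \<Rightarrow> 'a) set \<Rightarrow> ('s, 'a) algorithm \<Rightarrow> bool" where
  "proper Pol alg \<longleftrightarrow> (\<forall>hist \<pi>. alg hist = Stop \<pi> \<longrightarrow> \<pi> \<in> Pol)"

definition interaction_round ::
  "('s, 'a) mdp \<Rightarrow> (nat \<Rightarrow> 's pmf) \<Rightarrow> ('s, 'a) algorithm \<Rightarrow> ('s, 'a) trajectory list \<Rightarrow>
   ('s, 'a) trajectory list pmf" where
  "interaction_round M \<mu> alg hist =
     (case alg hist of
        Stop \<pi> \<Rightarrow> return_pmf hist
      | Reset h f \<Rightarrow>
          bind_pmf (\<mu> h) (\<lambda>x. map_pmf (\<lambda>\<tau>. hist @ [\<tau>]) (rollout_from M f h x)))"

text \<open>The history after at most \<open>n\<close> rounds; it no longer changes once the algorithm has stopped,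
  so its length is the number of trajectories sampled within these rounds.\<close>

primrec interaction ::
  "('s, 'a) mdp \<Rightarrow> (nat \<Rightarrow> 's pmf) \<Rightarrow> ('s, 'a) algorithm \<Rightarrow> nat \<Rightarrow>
   ('s, 'a) trajectory list pmf" where
  "interaction M \<mu> alg 0 = return_pmf []"
| "interaction M \<mu> alg (Suc n) = bind_pmf (interaction M \<mu> alg n) (interaction_round M \<mu> alg)"

text \<open>The event of having stopped within \<open>n\<close> rounds with a policy in \<open>G\<close> is increasing in \<open>n\<close>, so
  the supremum is the probability of ever stopping with a policy in \<open>G\<close>.\<close>

definition return_prob ::
  "('s, 'a) mdp \<Rightarrow> (nat \<Rightarrow> 's pmf) \<Rightarrow> ('s, 'a) algorithm \<Rightarrow> ('s \<Rightarrow> 'a) set \<Rightarrow> real" where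
  "return_prob M \<mu> alg G =
     (\<Squnion>n. measure_pmf.prob (interaction M \<mu> alg n) {hist. \<exists>\<pi>\<in>G. alg hist = Stop \<pi>})"

text \<open>The number of trajectories the algorithm may sample, over all outcomes of positive
  probability; it is \<open>\<infinity>\<close> if there is no bound, in particular if the algorithm may fail to stop.\<close>

definition num_trajectories ::
  "('s, 'a) mdp \<Rightarrow> (nat \<Rightarrow> 's pmf) \<Rightarrow> ('s, 'a) algorithm \<Rightarrow> ereal" where
  "num_trajectories M \<mu> alg =
     (\<Squnion>n. \<Squnion>hist\<in>set_pmf (interaction M \<mu> alg n). ereal (real (length hist)))"

end

theory Submission
  imports Defs "HOL-Real_Asymp.Real_Asymp"
begin

text \<open>
  A secret \<open>\<theta>\<close> of \<open>n = \<lfloor>sqrt H\<rfloor>\<close> bits prescribes the optimal action in each lock layer; a wrong action in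
  a lock layer leads to the worthless type ``null''. Each block of \<open>n\<close> lock layers ends with a bump
  layer, which pays a live state more and a dead state less than a null state, and then turns live
  into null and dead into live. Under the reset distribution the payments of the three types average
  to that of a null state, so a trajectory shows a deviation from the all-null behaviour only if its
  actions agree with \<open>\<theta>\<close> throughout a whole block. A dead state is compensated for its lower payment
  by being live in the next block; since there are two dead types per live type, the premium of a live
  state doubles from each block to the preceding one. It is therefore exponentially small at the
  final layer, where it is paid out with exponentially small probability, and constant at the first
  layer. The types are hidden by shifting the states by random offsets, so that they reveal nothing
  as long as no offset is met twice. Hence, averaged over the offsets, every history that neither
  repeats an offset nor agrees with \<open>\<theta>\<close> on a block is almost as likely as under an MDP that does
  not depend on \<open>\<theta>\<close>, and with few trajectories the output is right for few values of \<open>\<theta>\<close> only.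
\<close>

section \<open>Weights of histories\<close>

lemma pmf_bind_finite:
  assumes "finite A" "\<And>x. x \<notin> A \<Longrightarrow> pmf (f x) i = 0"
  shows "pmf (bind_pmf p f) i = (\<Sum>x\<in>A. pmf p x * pmf (f x) i)"
proof -
  have "pmf (bind_pmf p f) i = (\<integral>x. pmf (f x) i \<partial>measure_pmf p)" by (rule pmf_bind)
  also have "\<dots> = (\<Sum>x\<in>A. pmf (f x) i * pmf p x)"
    using assms by (intro integral_measure_pmf_real) auto
  finally show ?thesis by (simp add: mult.commute)
qed

lemma expectation_bind_le:
  fixes g :: "'b \<Rightarrow> real"
  assumes "finite (set_pmf p)" "\<And>x. x \<in> set_pmf p \<Longrightarrow> finite (set_pmf (f x))"
    and "\<And>x. x \<in> set_pmf p \<Longrightarrow> measure_pmf.expectation (f x) g \<le> c x"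
  shows "measure_pmf.expectation (bind_pmf p f) g \<le> measure_pmf.expectation p c"
proof -
  have "measure_pmf.expectation (bind_pmf p f) g
      = (\<Sum>x\<in>set_pmf p. pmf p x *\<^sub>R measure_pmf.expectation (f x) g)"
    using assms by (intro pmf_expectation_bind) auto
  also have "\<dots> \<le> (\<Sum>x\<in>set_pmf p. pmf p x * c x)"
    using assms by (auto intro!: sum_mono mult_left_mono)
  also have "\<dots> = measure_pmf.expectation p c"
    using assms by (subst integral_measure_pmf_real[of "set_pmf p"]) (auto simp: mult.commute)
  finally show ?thesis .
qed

text \<open>Union bound: either the first draw lands in the bad set \<open>B\<close>, or the second
  draw hits \<open>A\<close> with probability at most \<open>c\<close>.\<close>

lemma prob_bind_le:
  assumes "\<And>x. x \<in> set_pmf p \<Longrightarrow> x \<notin> B \<Longrightarrow> measure_pmf.prob (f x) A \<le> c" and "0 \<le> c"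
  shows "measure_pmf.prob (bind_pmf p f) A \<le> measure_pmf.prob p B + c"
proof -
  have "emeasure (bind_pmf p f) A = (\<integral>\<^sup>+x. emeasure (f x) A \<partial>p)" by simp
  also have "\<dots> \<le> (\<integral>\<^sup>+x. indicator B x + ennreal c \<partial>p)"
  proof (intro nn_integral_mono_AE, unfold AE_measure_pmf_iff, intro ballI)
    fix x assume x: "x \<in> set_pmf p"
    show "emeasure (f x) A \<le> indicator B x + ennreal c"
    proof (cases "x \<in> B")
      case True
      have "emeasure (f x) A \<le> 1" by (rule measure_pmf.emeasure_le_1)
      then show ?thesis using True by (simp add: add_increasing2)
    next
      case False
      then show ?thesis using assms(1)[OF x] by (simp add: measure_pmf.emeasure_eq_measure ennreal_leI)
    qed
  qed
  also have "\<dots> = ennreal (measure_pmf.prob p B + c)"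
    using assms(2) by (simp add: nn_integral_add measure_pmf.emeasure_eq_measure)
  finally show ?thesis
    using assms(2) by (simp add: measure_pmf.emeasure_eq_measure del: emeasure_bind_pmf ennreal_plus)
qed

text \<open>The last step has no transition factor, since \<open>rollout\<close> discards its
  successor. The first state has none either: its probability comes from the reset and not from the
  MDP.\<close>

fun traj_weight :: "('s, 'a) mdp \<Rightarrow> ('s, 'a) trajectory \<Rightarrow> real" where
  "traj_weight M [] = 1"
| "traj_weight M [(x, a, r)] = pmf (reward M x a) r"
| "traj_weight M ((x, a, r) # (x', a', r') # ys) =
     pmf (reward M x a) r * pmf (transition M x a) x' * traj_weight M ((x', a', r') # ys)"

fun follows ::
  "(('s, 'a) trajectory \<Rightarrow> 's \<Rightarrow> 'a) \<Rightarrow> ('s, 'a) trajectory \<Rightarrow> ('s, 'a) trajectory \<Rightarrow> bool" where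
  "follows f \<tau> [] \<longleftrightarrow> True"
| "follows f \<tau> ((x, a, r) # ys) \<longleftrightarrow> a = f \<tau> x \<and> follows f (\<tau> @ [(x, a, r)]) ys"

lemma traj_weight_nonneg: "0 \<le> traj_weight M ys"
  by (induction M ys rule: traj_weight.induct) auto

lemma traj_weight_Cons:
  "traj_weight M ((x, a, r) # ys) = pmf (reward M x a) r *
     (if ys = [] then 1 else pmf (transition M x a) (fst (hd ys)) * traj_weight M ys)"
  by (cases "(M, (x, a, r) # ys)" rule: traj_weight.cases) auto

lemma rollout_extends:
  "\<tau>' \<in> set_pmf (rollout M f k \<tau> x) \<Longrightarrow> \<exists>ys. \<tau>' = \<tau> @ ys \<and> length ys = k"
proof (induction k arbitrary: \<tau> x)
  case (Suc k)
  then obtain r x' where "\<tau>' \<in> set_pmf (rollout M f k (\<tau> @ [(x, f \<tau> x, r)]) x')" by auto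
  from Suc.IH[OF this] obtain ys where "\<tau>' = (\<tau> @ [(x, f \<tau> x, r)]) @ ys" "length ys = k" by blast
  then show ?case by (intro exI[of _ "(x, f \<tau> x, r) # ys"]) simp
qed simp

text \<open>As the actions are deterministic, only one reward and one successor per step are
  compatible with a given trajectory, so each bind collapses to a single term. The choice rule
  \<open>f\<close> enters through a 0/1 condition only.\<close>

lemma pmf_rollout:
  "pmf (rollout M f (length ys) \<tau> x) (\<tau> @ ys) =
     (if (ys = [] \<or> fst (hd ys) = x) \<and> follows f \<tau> ys then traj_weight M ys else 0)"
proof (induction ys arbitrary: \<tau> x)
  case (Cons y ys)
  obtain x1 a1 r1 where y: "y = (x1, a1, r1)" by (cases y)
  define a where "a = f \<tau> x"
  define W where "W = (\<lambda>r x'. rollout M f (length ys) (\<tau> @ [(x, a, r)]) x')"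
  have off: "pmf (W r x') (\<tau> @ y # ys) = 0" if "(x, a, r) \<noteq> y" for r x'
    using that rollout_extends unfolding W_def by (force simp: pmf_eq_0_set_pmf)
  have bind_zero: "pmf (bind_pmf p (W r)) (\<tau> @ y # ys) = 0" if "(x, a, r) \<noteq> y" for r p
    by (subst pmf_bind_finite[of "{}"]) (simp_all add: off[OF that])
  have eq: "pmf (W r x') (\<tau> @ y # ys) =
     (if (ys = [] \<or> fst (hd ys) = x') \<and> follows f (\<tau> @ [y]) ys then traj_weight M ys else 0)"
    if "(x, a, r) = y" for r x'
    using Cons.IH[of "\<tau> @ [y]" x'] that unfolding W_def by simp
  have inner: "pmf (bind_pmf (transition M x a) (W r1)) (\<tau> @ y # ys) =
      (if follows f (\<tau> @ [y]) ys then
        (if ys = [] then 1 else pmf (transition M x a) (fst (hd ys)) * traj_weight M ys) else 0)"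
    if "x = x1" "a = a1"
  \<comment> \<open>If no step remains, every successor yields the same trajectory, so the
    transition contributes the factor 1 instead of the probability of one state.\<close>
  proof (cases "ys = []")
    case True
    then have "W r1 = (\<lambda>_. return_pmf (\<tau> @ [y]))" using that y by (simp add: W_def)
    then show ?thesis using True by simp
  next
    case False
    have "(x, a, r1) = y" using that y by simp
    note eq' = eq[OF this]
    show ?thesis
      using False by (subst pmf_bind_finite[of "{fst (hd ys)}"]) (simp_all add: eq')
  qed
  have "pmf (rollout M f (length (y # ys)) \<tau> x) (\<tau> @ y # ys) =
      pmf (reward M x a) r1 * pmf (bind_pmf (transition M x a) (W r1)) (\<tau> @ y # ys)"
  proof -
    have "pmf (bind_pmf (transition M x a) (W r)) (\<tau> @ y # ys) = 0" if "r \<notin> {r1}" for r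
      by (rule bind_zero) (use that y in simp)
    moreover have "rollout M f (length (y # ys)) \<tau> x =
        bind_pmf (reward M x a) (\<lambda>r. bind_pmf (transition M x a) (W r))"
      by (simp add: W_def a_def)
    ultimately show ?thesis
      by (simp only:) (subst pmf_bind_finite[of "{r1}"]; simp)
  qed
  also have "\<dots> = (if fst y = x \<and> follows f \<tau> (y # ys) then traj_weight M (y # ys) else 0)"
  proof (cases "x = x1 \<and> a = a1")
    case True
    then have "follows f \<tau> (y # ys) \<longleftrightarrow> follows f (\<tau> @ [y]) ys" "fst y = x"
      "traj_weight M (y # ys) = pmf (reward M x a) r1 *
         (if ys = [] then 1 else pmf (transition M x a) (fst (hd ys)) * traj_weight M ys)"
      using y by (auto simp: a_def traj_weight_Cons)
    then show ?thesis using inner True by simp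
  next
    case False
    then have "pmf (bind_pmf (transition M x a) (W r1)) (\<tau> @ y # ys) = 0"
      by (intro bind_zero) (use y in auto)
    then show ?thesis using False y a_def by auto
  qed
  finally show ?case by simp
qed simp

text \<open>The coefficient collects everything that does not depend on the MDP: the reset distributions
  and the consistency of the history with the algorithm.\<close>

lemma pmf_interaction:
  assumes alg: "is_algorithm H alg"
  shows "\<exists>\<kappa>\<ge>0. \<forall>M. horizon M = H \<longrightarrow>
    pmf (interaction M \<mu> alg t) hist = \<kappa> * prod_list (map (traj_weight M) hist)"
proof (induction t arbitrary: hist)
  case 0
  show ?case by (intro exI[of _ "of_bool (hist = [])"]) auto
next
  case (Suc t)
  obtain \<kappa>1 where \<kappa>1: "0 \<le> \<kappa>1" "\<And>M. horizon M = H \<Longrightarrow>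
      pmf (interaction M \<mu> alg t) hist = \<kappa>1 * prod_list (map (traj_weight M) hist)"
    using Suc[of hist] by blast
  obtain \<kappa>2 where \<kappa>2: "0 \<le> \<kappa>2" "\<And>M. horizon M = H \<Longrightarrow> pmf (interaction M \<mu> alg t) (butlast hist)
      = \<kappa>2 * prod_list (map (traj_weight M) (butlast hist))"
    using Suc[of "butlast hist"] by blast
  \<comment> \<open>There are two ways to hold \<open>hist\<close> after one more round: the
    algorithm had already stopped with it (\<open>d1\<close>), or its last trajectory has just been
    sampled (\<open>d2\<close>).\<close>
  define d1 where "d1 = (case alg hist of Stop \<pi> \<Rightarrow> 1 | Reset h f \<Rightarrow> (0::real))"
  define d2 where "d2 = (if hist = [] then 0 else case alg (butlast hist) of Stop \<pi> \<Rightarrow> 0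
     | Reset h f \<Rightarrow> if length (last hist) = Suc H - h \<and> follows f [] (last hist)
         then pmf (\<mu> h) (fst (hd (last hist))) else 0)"
  have off: "pmf (interaction_round M \<mu> alg h') hist = 0"
    if "h' \<noteq> hist" "hist = [] \<or> h' \<noteq> butlast hist" for M h'
    using that by (cases "alg h'") (auto simp: interaction_round_def pmf_eq_0_set_pmf)
  have on1: "pmf (interaction_round M \<mu> alg hist) hist = d1" for M
    by (auto simp: interaction_round_def d1_def pmf_eq_0_set_pmf split: move.splits)
  have on2: "pmf (interaction_round M \<mu> alg (butlast hist)) hist = d2 * traj_weight M (last hist)"
    if ne: "hist \<noteq> []" and M: "horizon M = H" for M
  proof (cases "alg (butlast hist)")
    case (Stop \<pi>)
    moreover have "butlast hist \<noteq> hist" using ne by (metis append_butlast_last_id append_self_conv list.distinct(1))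
    ultimately show ?thesis by (simp add: interaction_round_def d2_def)
  next
    case (Reset h f)
    define l where "l = last hist"
    have h: "1 \<le> h" "h \<le> H" using alg Reset by (auto simp: is_algorithm_def)
    have hist: "hist = butlast hist @ [l]" using ne by (simp add: l_def)
    have inj: "inj (\<lambda>\<tau>. butlast hist @ [\<tau>])" by (auto simp: inj_def)
    have map: "pmf (map_pmf (\<lambda>\<tau>. butlast hist @ [\<tau>]) p) hist = pmf p l" for p
      by (subst hist) (rule pmf_map_inj'[OF inj])
    have roll: "pmf (rollout_from M f h x) l = (if length l = Suc H - h \<and> fst (hd l) = x \<and> follows f [] l
        then traj_weight M l else 0)" for x
    proof (cases "length l = Suc H - h")
      case True
      then have "l \<noteq> []" using h by auto
      then show ?thesis
        using pmf_rollout[of M f l "[]" x] True M by (simp add: rollout_from_def)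
    next
      case False
      then show ?thesis using rollout_extends[of l M f "Suc H - h" "[]" x] M
        by (auto simp: rollout_from_def pmf_eq_0_set_pmf)
    qed
    have "pmf (interaction_round M \<mu> alg (butlast hist)) hist =
        pmf (\<mu> h) (fst (hd l)) * pmf (rollout_from M f h (fst (hd l))) l"
      by (simp add: interaction_round_def Reset)
         (subst pmf_bind_finite[of "{fst (hd l)}"]; simp add: map roll)
    then show ?thesis using ne Reset roll by (simp add: d2_def l_def[symmetric])
  qed
  show ?case
  proof (intro exI[of _ "\<kappa>1 * d1 + \<kappa>2 * d2"] conjI allI impI)
    show "0 \<le> \<kappa>1 * d1 + \<kappa>2 * d2"
      using \<kappa>1 \<kappa>2 by (auto simp: d1_def d2_def split: move.splits)
    fix M :: "('a, 'b) mdp" assume M: "horizon M = H"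
    show "pmf (interaction M \<mu> alg (Suc t)) hist
        = (\<kappa>1 * d1 + \<kappa>2 * d2) * prod_list (map (traj_weight M) hist)"
    proof (cases "hist = []")
      case True
      then have "d2 = 0" by (simp add: d2_def)
      moreover have "pmf (interaction M \<mu> alg (Suc t)) hist
          = (\<Sum>h'\<in>{hist}. pmf (interaction M \<mu> alg t) h' * pmf (interaction_round M \<mu> alg h') hist)"
        unfolding interaction.simps by (rule pmf_bind_finite) (use True off in simp_all)
      ultimately show ?thesis using \<kappa>1(2)[OF M] on1 by simp
    next
      case False
      have ne: "hist \<noteq> butlast hist"
        using False by (metis append_butlast_last_id append_self_conv list.distinct(1))
      have "pmf (interaction M \<mu> alg (Suc t)) hist
          = (\<Sum>h'\<in>{hist, butlast hist}. pmf (interaction M \<mu> alg t) h' * pmf (interaction_round M \<mu> alg h') hist)"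
        unfolding interaction.simps by (rule pmf_bind_finite) (use off in simp_all)
      also have "\<dots> = \<kappa>1 * d1 * prod_list (map (traj_weight M) hist)
          + \<kappa>2 * d2 * (prod_list (map (traj_weight M) (butlast hist)) * traj_weight M (last hist))"
        using ne \<kappa>1(2)[OF M] \<kappa>2(2)[OF M] on1 on2[OF False M] by (simp add: algebra_simps)
      also have "prod_list (map (traj_weight M) (butlast hist)) * traj_weight M (last hist)
          = prod_list (map (traj_weight M) (butlast hist @ [last hist]))" by simp
      also have "butlast hist @ [last hist] = hist" using False by simp
      finally show ?thesis by (simp add: algebra_simps)
    qed
  qed
qed

section \<open>Stopping and success within a bounded number of rounds\<close>

lemma interaction_length:
  "hist \<in> set_pmf (interaction M \<mu> alg t) \<Longrightarrow>
     length hist \<le> t \<and> (length hist < t \<longrightarrow> (\<exists>\<pi>. alg hist = Stop \<pi>))"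
proof (induction t arbitrary: hist)
  case (Suc t)
  then obtain h' where h': "h' \<in> set_pmf (interaction M \<mu> alg t)"
    and r: "hist \<in> set_pmf (interaction_round M \<mu> alg h')" by auto
  show ?case using Suc.IH[OF h'] r
    by (auto simp: interaction_round_def split: move.splits)
qed simp

definition success_prob ::
  "('s, 'a) mdp \<Rightarrow> (nat \<Rightarrow> 's pmf) \<Rightarrow> ('s, 'a) algorithm \<Rightarrow> ('s \<Rightarrow> 'a) set \<Rightarrow> nat \<Rightarrow> real" where
  "success_prob M \<mu> alg G t =
     measure_pmf.prob (interaction M \<mu> alg t) {hist. \<exists>\<pi>\<in>G. alg hist = Stop \<pi>}"

lemma success_prob_mono: "success_prob M \<mu> alg G t \<le> success_prob M \<mu> alg G (Suc t)"
proof -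
  let ?A = "{hist. \<exists>\<pi>\<in>G. alg hist = Stop \<pi>}"
  have "measure_pmf.prob (interaction M \<mu> alg (Suc t)) (- ?A)
      \<le> measure_pmf.prob (interaction M \<mu> alg t) (- ?A) + 0"
    unfolding interaction.simps
    by (rule prob_bind_le) (auto simp: interaction_round_def)
  then show ?thesis
    using measure_pmf.prob_compl[of ?A "interaction M \<mu> alg t"]
      measure_pmf.prob_compl[of ?A "interaction M \<mu> alg (Suc t)"]
    by (simp add: success_prob_def Compl_eq_Diff_UNIV del: interaction.simps)
qed

text \<open>A history shorter than the number of rounds belongs to a run that has stopped. If this
  holds for all histories after \<open>T\<close> rounds, the interaction is constant from then on,
  and the supremum over the rounds is reached at \<open>T\<close>.\<close>

lemma return_prob_le_success:
  assumes "\<And>hist. hist \<in> set_pmf (interaction M \<mu> alg T) \<Longrightarrow> length hist < T"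
  shows "return_prob M \<mu> alg G \<le> success_prob M \<mu> alg G T"
proof -
  have stop: "\<exists>\<pi>. alg hist = Stop \<pi>" if "hist \<in> set_pmf (interaction M \<mu> alg T)" for hist
    using interaction_length[OF that] assms[OF that] by blast
  have const: "interaction M \<mu> alg (T + k) = interaction M \<mu> alg T" for k
  proof (induction k)
    case (Suc k)
    have "interaction M \<mu> alg (T + Suc k) = bind_pmf (interaction M \<mu> alg T) (interaction_round M \<mu> alg)"
      using Suc by simp
    also have "\<dots> = bind_pmf (interaction M \<mu> alg T) return_pmf"
      by (rule bind_pmf_cong) (auto dest!: stop simp: interaction_round_def)
    finally show ?case by (simp add: bind_return_pmf')
  qed simp
  have "success_prob M \<mu> alg G t \<le> success_prob M \<mu> alg G T" for t
  proof (cases "t \<le> T")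
    case True
    then show ?thesis
      using lift_Suc_mono_le[of "success_prob M \<mu> alg G", OF success_prob_mono] by blast
  next
    case False
    then have "interaction M \<mu> alg t = interaction M \<mu> alg T" using const[of "t - T"] by simp
    then show ?thesis by (simp add: success_prob_def)
  qed
  then show ?thesis unfolding return_prob_def success_prob_def by (intro cSUP_least) auto
qed

lemma length_less_of_num_trajectories:
  assumes "num_trajectories M \<mu> alg < ereal b" "hist \<in> set_pmf (interaction M \<mu> alg t)"
  shows "real (length hist) < b"
proof -
  have "ereal (real (length hist)) \<le> num_trajectories M \<mu> alg"
    unfolding num_trajectories_def
    by (rule SUP_upper2[where i = t], simp, rule SUP_upper[OF assms(2)])
  then have "ereal (real (length hist)) < ereal b" using assms(1) by (rule order.strict_trans1)
  then show ?thesis by simp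
qed

section \<open>The hard MDPs\<close>

lemma cumulative_reward_Nil [simp]: "cumulative_reward [] = 0"
  by (simp add: cumulative_reward_def)

lemma rollout_finite:
  assumes "\<And>x a. finite (set_pmf (reward M x a))" "\<And>x a. finite (set_pmf (transition M x a))"
  shows "finite (set_pmf (rollout M f k \<tau> x))"
  by (induction k arbitrary: \<tau> x) (simp_all add: assms)

text \<open>
  Layers \<open>1, \<dots>, m * Suc n\<close> form \<open>m\<close> blocks of \<open>n\<close> lock layers and one bump layer each.
  A state \<open>x\<close> lies in layer \<open>x div (4 * N)\<close>; its type is the residue of \<open>x\<close> modulo 4, shifted by the
  secret \<open>\<sigma> (x div 4)\<close>. Type 0 is live, types 1 and 2 are dead, type 3 is null.
\<close>

locale lock_family =
  fixes n m N H :: nat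
  assumes n_pos: "1 \<le> n" and m_pos: "1 \<le> m" and N_pos: "1 \<le> N" and H_large: "m * Suc n < H"
begin

section \<open>Layers, types, rewards and policies of the family\<close>

definition lay :: "nat \<Rightarrow> nat" where "lay x = x div (4 * N)"

definition X :: "nat \<Rightarrow> nat set" where "X h = {4 * N * h..<4 * N * Suc h}"

text \<open>Layer 1 is exempt from the shift because the reset distribution must agree there with
  the initial distribution: all its states are live, so that the initial value carries the full
  premium. In other layers the four states sharing the offset \<open>\<sigma> (x div 4)\<close> show
  each type once.\<close>

definition type_of :: "(nat \<Rightarrow> nat) \<Rightarrow> nat \<Rightarrow> nat" where
  "type_of \<sigma> x = (if lay x = 1 then 0 else (x + \<sigma> (x div 4)) mod 4)"

definition cell :: "(nat \<Rightarrow> nat) \<Rightarrow> nat \<Rightarrow> nat \<Rightarrow> nat set" where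
  "cell \<sigma> h z = {x \<in> X h. type_of \<sigma> x = z}"

definition bump :: "nat \<Rightarrow> bool" where "bump h \<longleftrightarrow> h \<le> m * Suc n \<and> h mod Suc n = 0"

definition lock :: "nat \<Rightarrow> bool" where "lock h \<longleftrightarrow> h \<le> m * Suc n \<and> h mod Suc n \<noteq> 0"

text \<open>The exponent counts the blocks completed before layer \<open>h\<close>; the minimum
  freezes it in the filler layers after the last block.\<close>

definition q :: "nat \<Rightarrow> real" where "q h = (1 / 2) ^ min m ((h - 1) div Suc n)"

text \<open>Chosen so that the expected final payment \<open>leak / 4\<close> of a live state is the
  premium \<open>3 / 16 * (1 / 2) ^ m\<close> left after the last block.\<close>

definition leak :: real where "leak = 3 / 4 * (1 / 2) ^ m"

definition step :: "nat set \<Rightarrow> nat \<Rightarrow> bool \<Rightarrow> nat \<Rightarrow> nat" where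
  "step \<theta> h a z =
     (if lock h then (if a = (h mod Suc n \<in> \<theta>) then z else 3)
      else if bump h then (if z = 1 \<or> z = 2 then 0 else 3) else z)"

text \<open>The caps of the bump layers form a geometric series with sum below \<open>3 / 4\<close>;
  with the final \<open>1 / 4\<close> every trajectory stays within total reward 1.\<close>

definition cap :: "nat \<Rightarrow> real" where
  "cap h = (if h = H then 1 / 4 else if bump h then 3 / 8 * q h else 0)"

text \<open>At a bump the four probabilities 1, 1/4, 1/4, 1/2 have mean 1/2, the value for a null
  state. A live state gains \<open>cap h / 2 = 3 / 16 * q h\<close> over a null one, a dead state
  loses half as much.\<close>

definition rp :: "nat \<Rightarrow> nat \<Rightarrow> real" where
  "rp h z = (if h = H then (if z = 0 then leak else 0)
     else if bump h then (if z = 0 then 1 else if z = 1 \<or> z = 2 then 1 / 4 else 1 / 2) else 0)"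

definition rew :: "nat \<Rightarrow> nat \<Rightarrow> real pmf" where
  "rew h z = map_pmf (\<lambda>b. if b then cap h else 0) (bernoulli_pmf (rp h z))"

definition hard_mdp :: "nat set \<Rightarrow> (nat \<Rightarrow> nat) \<Rightarrow> (nat, bool) mdp" where
  "hard_mdp \<theta> \<sigma> = \<lparr>layer = X, horizon = H,
     transition = (\<lambda>x a. pmf_of_set (cell \<sigma> (Suc (lay x)) (step \<theta> (lay x) a (type_of \<sigma> x)))),
     reward = (\<lambda>x a. rew (lay x) (type_of \<sigma> x)),
     init = pmf_of_set (X 1)\<rparr>"

text \<open>The reference process: every state pays like a null state, and successors are uniform
  over the whole layer, as they appear when all types are hidden.\<close>

definition null_mdp :: "(nat, bool) mdp" where
  "null_mdp = \<lparr>layer = X, horizon = H,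
     transition = (\<lambda>x a. pmf_of_set (X (Suc (lay x)))),
     reward = (\<lambda>x a. rew (lay x) 3),
     init = pmf_of_set (X 1)\<rparr>"

definition reset_dist :: "nat \<Rightarrow> nat pmf" where "reset_dist h = pmf_of_set (X h)"

text \<open>The same bits are used in every block. The policy reads only the layer and not the
  offsets, which keeps the class at one policy per secret although there are many MDPs per
  secret.\<close>

definition pol :: "nat set \<Rightarrow> nat \<Rightarrow> bool" where
  "pol \<theta> = restrict (\<lambda>x. lay x mod Suc n \<in> \<theta>) (total_states H X)"

definition Pol :: "(nat \<Rightarrow> bool) set" where "Pol = pol ` Pow {1..n}"

text \<open>The term \<open>3 / 16 * q h\<close> is the premium of a live state; null and dead states have equal values.\<close>

definition Vopt :: "nat \<Rightarrow> nat \<Rightarrow> real" where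
  "Vopt h z = (if h > H then 0
     else 3 / 8 * (q h - (1 / 2) ^ m) + (if z = 0 then 3 / 16 * q h else 0))"

section \<open>Sizes of layers and cells, the premium factor, and the reward distributions\<close>

lemma block_le: "Suc n \<le> m * Suc n"
  using mult_le_mono1[OF m_pos, of "Suc n"] by simp

lemma mem_X: "x \<in> X h \<longleftrightarrow> lay x = h"
proof
  assume "x \<in> X h"
  then show "lay x = h" unfolding lay_def by (intro div_nat_eqI) (auto simp: X_def mult_ac)
next
  assume "lay x = h"
  then show "x \<in> X h"
    using times_div_less_eq_dividend[of "4 * N" x] dividend_less_times_div[of "4 * N" x] N_pos
    by (auto simp: X_def lay_def)
qed

lemma finite_X [simp]: "finite (X h)" and card_X: "card (X h) = 4 * N" and X_nonempty [simp]: "X h \<noteq> {}"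
  using N_pos by (auto simp: X_def algebra_simps)

lemma type_of_less: "type_of \<sigma> x < 4"
  by (simp add: type_of_def)

lemma lay_key: "lay x = x div 4 div N"
  by (simp add: lay_def div_mult2_eq)

lemma card_cell:
  assumes "h \<noteq> 1" "z < 4"
  shows "card (cell \<sigma> h z) = N"
proof -
  \<comment> \<open>Modulo 4, adding \<open>3 * \<sigma> k\<close> means subtracting
    \<open>\<sigma> k\<close>. Hence \<open>g k\<close> is the one state of type \<open>z\<close>
    among the four with offset \<open>\<sigma> k\<close>.\<close>
  define g where "g = (\<lambda>k. 4 * k + (z + 3 * \<sigma> k) mod 4)"
  have "bij_betw g {N * h..<N * Suc h} (cell \<sigma> h z)"
  proof (rule bij_betw_byWitness[where f' = "\<lambda>x. x div 4"])
    show "\<forall>k\<in>{N * h..<N * Suc h}. g k div 4 = k" by (simp add: g_def)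
    show "\<forall>x\<in>cell \<sigma> h z. g (x div 4) = x"
    proof
      fix x assume "x \<in> cell \<sigma> h z"
      then have "(x + \<sigma> (x div 4)) mod 4 = z" using assms by (auto simp: cell_def mem_X type_of_def)
      then have "(z + 3 * \<sigma> (x div 4)) mod 4 = (x + \<sigma> (x div 4) + 3 * \<sigma> (x div 4)) mod 4"
        using mod_add_left_eq by metis
      also have "x + \<sigma> (x div 4) + 3 * \<sigma> (x div 4) = x + \<sigma> (x div 4) * 4" by simp
      also have "\<dots> mod 4 = x mod 4" by (rule mod_mult_self1)
      finally show "g (x div 4) = x" by (simp add: g_def)
    qed
    show "g ` {N * h..<N * Suc h} \<subseteq> cell \<sigma> h z"
    proof
      fix x assume "x \<in> g ` {N * h..<N * Suc h}"
      then obtain k where k: "N * h \<le> k" "k < N * Suc h" "x = g k" by auto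
      have div: "x div 4 = k" using k by (simp add: g_def)
      have "k div N = h" using k by (intro div_nat_eqI) (auto simp: mult.commute)
      then have lay: "lay x = h" by (simp add: lay_key div)
      have "(g k + \<sigma> k) mod 4 = ((4 * k + \<sigma> k) + (z + 3 * \<sigma> k) mod 4) mod 4"
        by (simp add: g_def algebra_simps)
      also have "\<dots> = ((4 * k + \<sigma> k) + (z + 3 * \<sigma> k)) mod 4" by (rule mod_add_right_eq)
      also have "(4 * k + \<sigma> k) + (z + 3 * \<sigma> k) = z + (k + \<sigma> k) * 4" by simp
      also have "\<dots> mod 4 = z mod 4" by (rule mod_mult_self1)
      also have "\<dots> = z" using assms(2) by simp
      finally have "(g k + \<sigma> k) mod 4 = z" .
      then have "type_of \<sigma> x = z" using assms(1) lay div k by (simp add: type_of_def)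
      then show "x \<in> cell \<sigma> h z" using lay by (simp add: cell_def mem_X)
    qed
    show "(\<lambda>x. x div 4) ` cell \<sigma> h z \<subseteq> {N * h..<N * Suc h}"
      by (auto simp: cell_def X_def)
  qed
  from bij_betw_same_card[OF this] show ?thesis by simp
qed

lemma finite_cell [simp]: "finite (cell \<sigma> h z)"
  by (simp add: cell_def)

lemma cell_nonempty: "h \<noteq> 1 \<Longrightarrow> z < 4 \<Longrightarrow> cell \<sigma> h z \<noteq> {}"
  using card_cell[of h z \<sigma>] N_pos by (metis card.empty not_one_le_zero)

lemma step_less: "z < 4 \<Longrightarrow> step \<theta> h a z < 4"
  by (auto simp: step_def)

lemma step_null: "step \<theta> h a 3 = 3"
  by (auto simp: step_def)

lemma set_pmf_transition:
  "lay x \<noteq> 0 \<Longrightarrow> set_pmf (transition (hard_mdp \<theta> \<sigma>) x a)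
     = cell \<sigma> (Suc (lay x)) (step \<theta> (lay x) a (type_of \<sigma> x))"
  by (simp add: hard_mdp_def cell_nonempty step_less type_of_less)

lemma q_bump:
  assumes "bump h" "1 \<le> h"
  shows "q (Suc h) = q h / 2" "h < H"
proof -
  obtain k where k: "h = Suc n * k" using assms by (auto simp: bump_def mod_eq_0_iff_dvd dvd_def)
  then obtain k' where k': "k = Suc k'" using assms by (cases k) auto
  have "h \<le> m * Suc n" using assms by (simp add: bump_def)
  then have "k \<le> m" using k by (metis mult.commute mult_le_cancel2 zero_less_Suc)
  have "(h - 1) div Suc n = k'" using k k' by (intro div_nat_eqI) auto
  moreover have "h div Suc n = Suc k'" using k k' by (simp del: mult_Suc mult_Suc_right)
  ultimately show "q (Suc h) = q h / 2" using \<open>k \<le> m\<close> k' by (simp add: q_def min_def)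
  show "h < H" using H_large assms by (simp add: bump_def)
qed

lemma q_not_bump:
  assumes "\<not> bump h" "1 \<le> h"
  shows "q (Suc h) = q h"
proof (cases "h \<le> m * Suc n")
  case True
  then have "h mod Suc n \<noteq> 0" using assms by (simp add: bump_def)
  moreover obtain g where "h = Suc g" using assms by (cases h) auto
  ultimately have "h div Suc n = (h - 1) div Suc n" by (metis diff_Suc_1 div_Suc)
  then show ?thesis by (simp add: q_def)
next
  case False
  then have "m \<le> (h - 1) div Suc n" by (simp add: less_eq_div_iff_mult_less_eq)
  moreover have "(h - 1) div Suc n \<le> h div Suc n" by (intro div_le_mono) simp
  ultimately show ?thesis by (simp add: q_def min_def)
qed

lemma q_filler: "m * Suc n < h \<Longrightarrow> q h = (1 / 2) ^ m"
proof -
  assume "m * Suc n < h"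
  then have "m \<le> (h - 1) div Suc n" by (simp add: less_eq_div_iff_mult_less_eq)
  then show ?thesis by (simp add: q_def min_def)
qed

lemma q_one: "q 1 = 1"
  by (simp add: q_def)

lemma q_pos: "0 < q h"
  by (simp add: q_def)

lemma leak_bounds: "0 \<le> leak" "leak \<le> 1"
proof -
  have "(1 / 2 :: real) ^ m \<le> 1" by (simp add: power_le_one)
  then show "0 \<le> leak" "leak \<le> 1" by (auto simp: leak_def)
qed

lemma rp_bounds: "0 \<le> rp h z" "rp h z \<le> 1"
  using leak_bounds by (auto simp: rp_def)

lemma cap_nonneg: "0 \<le> cap h"
  using q_pos[of h] by (simp add: cap_def)

lemma set_pmf_rew: "set_pmf (rew h z) \<subseteq> {0, cap h}"
  by (auto simp: rew_def)

lemma finite_rew [simp]: "finite (set_pmf (rew h z))"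
  using set_pmf_rew finite_subset by blast

lemma expectation_rew:
  "measure_pmf.expectation (rew h z) (\<lambda>r. r + c) = rp h z * cap h + c"
  using rp_bounds by (simp add: rew_def algebra_simps)

lemma pmf_rew: "pmf (rew h z) r = rp h z * of_bool (r = cap h) + (1 - rp h z) * of_bool (r = 0)"
proof -
  have sum_bool: "(\<Sum>b\<in>{True, False}. F b) = F True + F False" for F :: "bool \<Rightarrow> real" by simp
  have "pmf (rew h z) r = (\<Sum>b\<in>{True, False}. pmf (bernoulli_pmf (rp h z)) b
      * pmf (return_pmf (if b then cap h else 0)) r)"
    unfolding rew_def map_pmf_def by (rule pmf_bind_finite) auto
  also have "\<dots> = pmf (bernoulli_pmf (rp h z)) True * pmf (return_pmf (cap h)) r
      + pmf (bernoulli_pmf (rp h z)) False * pmf (return_pmf 0) r"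
    unfolding sum_bool by simp
  also have "\<dots> = rp h z * pmf (return_pmf (cap h)) r + (1 - rp h z) * pmf (return_pmf 0) r"
    using rp_bounds by (simp only: pmf_bernoulli_True pmf_bernoulli_False)
  finally show ?thesis by (simp add: indicator_def)
qed

section \<open>Bellman equations and the values of the policies\<close>

lemma bellman_le:
  assumes "1 \<le> h" "h \<le> H"
  shows "rp h z * cap h + Vopt (Suc h) (step \<theta> h a z) \<le> Vopt h z"
proof -
  consider "h = H" | "h \<noteq> H" "bump h" | "h \<noteq> H" "\<not> bump h" by blast
  then show ?thesis
  proof cases
    case 1
    then show ?thesis using q_filler[OF H_large] by (simp add: rp_def cap_def Vopt_def leak_def)
  next
    case 2
    then have "\<not> lock h" by (auto simp: lock_def bump_def)
    \<comment> \<open>The premium of a live state is paid out here. A dead state is paid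
      \<open>3 / 32 * q h\<close> less than a null one and becomes live, where its premium is
      \<open>3 / 16 * q h / 2\<close>, exactly the loss.\<close>
    then show ?thesis using q_bump(1)[OF 2(2) assms(1)] q_bump(2)[OF 2(2) assms(1)] 2 q_pos[of h]
      by (simp add: rp_def cap_def Vopt_def step_def field_simps)
  next
    case 3
    then show ?thesis using q_not_bump[of h] assms q_pos[of h]
      by (auto simp: rp_def cap_def Vopt_def step_def)
  qed
qed

text \<open>Value can be lost only by a wrong action in a lock layer: elsewhere actions have no
  effect, and a null state has no premium to lose.\<close>

lemma bellman_eq:
  assumes "1 \<le> h" "h \<le> H" "z = 3 \<or> a = (h mod Suc n \<in> \<theta>) \<or> \<not> lock h"
  shows "rp h z * cap h + Vopt (Suc h) (step \<theta> h a z) = Vopt h z"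
proof -
  consider "h = H" | "h \<noteq> H" "bump h" | "h \<noteq> H" "\<not> bump h" by blast
  then show ?thesis
  proof cases
    case 1
    then show ?thesis using q_filler[OF H_large] by (simp add: rp_def cap_def Vopt_def leak_def)
  next
    case 2
    then have "\<not> lock h" by (auto simp: lock_def bump_def)
    then show ?thesis using q_bump(1)[OF 2(2) assms(1)] q_bump(2)[OF 2(2) assms(1)] 2 q_pos[of h]
      by (simp add: rp_def cap_def Vopt_def step_def field_simps)
  next
    case 3
    then show ?thesis using q_not_bump[of h] assms q_pos[of h]
      by (auto simp: rp_def cap_def Vopt_def step_def)
  qed
qed

lemma horizon_hard_mdp [simp]: "horizon (hard_mdp \<theta> \<sigma>) = H"
  by (simp add: hard_mdp_def)

text \<open>A verification argument by induction on the remaining steps. \<open>U\<close> is the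
  candidate value, \<open>I\<close> an invariant of the types and \<open>A\<close> a restriction of
  the actions; \<open>c = 1\<close> gives upper bounds on values and \<open>c = -1\<close> lower
  bounds.\<close>

lemma rollout_value:
  fixes c :: real
  assumes inv: "\<And>h a z. 1 \<le> h \<Longrightarrow> h \<le> H \<Longrightarrow> I h z \<Longrightarrow> A h a \<Longrightarrow>
      I (Suc h) (step \<theta> h a z) \<and> c * (rp h z * cap h + U (Suc h) (step \<theta> h a z)) \<le> c * U h z"
    and fin: "\<And>z. U (Suc H) z = 0"
    and act: "\<And>\<tau> x. lay x \<in> {1..H} \<Longrightarrow> A (lay x) (f \<tau> x)"
  shows "lay x = h \<Longrightarrow> 1 \<le> h \<Longrightarrow> h + k = Suc H \<Longrightarrow> I h (type_of \<sigma> x) \<Longrightarrow>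
    finite (set_pmf (rollout (hard_mdp \<theta> \<sigma>) f k \<tau> x)) \<and>
    measure_pmf.expectation (rollout (hard_mdp \<theta> \<sigma>) f k \<tau> x) (\<lambda>t. c * cumulative_reward t)
      \<le> c * (cumulative_reward \<tau> + U h (type_of \<sigma> x))"
proof (induction k arbitrary: \<tau> x h)
  case 0
  then show ?case using fin by simp
next
  case (Suc k)
  let ?M = "hard_mdp \<theta> \<sigma>"
  define a where "a = f \<tau> x"
  define z where "z = type_of \<sigma> x"
  define z' where "z' = step \<theta> h a z"
  have h: "1 \<le> h" "h \<le> H" using Suc.prems by auto
  have A: "A h a" using act[of x \<tau>] Suc.prems h by (simp add: a_def)
  have Iz: "I h z" using Suc.prems by (simp add: z_def)
  note inv' = inv[OF h Iz A, folded z'_def]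
  have tr: "set_pmf (transition ?M x a) = cell \<sigma> (Suc h) z'"
    using set_pmf_transition[of x \<theta> \<sigma> a] Suc.prems by (simp add: z'_def z_def)
  have IH: "finite (set_pmf (rollout ?M f k (\<tau> @ [(x, a, r)]) x')) \<and>
      measure_pmf.expectation (rollout ?M f k (\<tau> @ [(x, a, r)]) x') (\<lambda>t. c * cumulative_reward t)
      \<le> c * (cumulative_reward \<tau> + r + U (Suc h) z')"
    if "x' \<in> set_pmf (transition ?M x a)" for r x'
  proof -
    have "lay x' = Suc h" "type_of \<sigma> x' = z'" using that tr by (auto simp: cell_def mem_X)
    then show ?thesis
      using Suc.IH[of x' "Suc h" "\<tau> @ [(x, a, r)]"] inv' Suc.prems
      by (simp add: cumulative_reward_def)
  qed
  have fin1: "finite (set_pmf (bind_pmf (transition ?M x a) (\<lambda>x'. rollout ?M f k (\<tau> @ [(x, a, r)]) x')))" for r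
    using IH by (auto simp: tr)
  have le1: "measure_pmf.expectation (bind_pmf (transition ?M x a) (\<lambda>x'. rollout ?M f k (\<tau> @ [(x, a, r)]) x'))
      (\<lambda>t. c * cumulative_reward t) \<le> c * (cumulative_reward \<tau> + r + U (Suc h) z')" for r
  proof -
    have "measure_pmf.expectation (bind_pmf (transition ?M x a) (\<lambda>x'. rollout ?M f k (\<tau> @ [(x, a, r)]) x'))
      (\<lambda>t. c * cumulative_reward t)
      \<le> measure_pmf.expectation (transition ?M x a) (\<lambda>_. c * (cumulative_reward \<tau> + r + U (Suc h) z'))"
      using IH by (intro expectation_bind_le) (auto simp: tr)
    then show ?thesis by simp
  qed
  have eq: "rollout ?M f (Suc k) \<tau> x = bind_pmf (reward ?M x a) (\<lambda>r.
      bind_pmf (transition ?M x a) (\<lambda>x'. rollout ?M f k (\<tau> @ [(x, a, r)]) x'))"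
    by (simp add: a_def)
  have rew: "reward ?M x a = rew h z" using Suc.prems by (simp add: hard_mdp_def z_def)
  have "measure_pmf.expectation (rollout ?M f (Suc k) \<tau> x) (\<lambda>t. c * cumulative_reward t)
      \<le> measure_pmf.expectation (rew h z) (\<lambda>r. c * (cumulative_reward \<tau> + r + U (Suc h) z'))"
    unfolding eq rew using le1 fin1 by (intro expectation_bind_le) auto
  also have "(\<lambda>r. c * (cumulative_reward \<tau> + r + U (Suc h) z'))
      = (\<lambda>r. c * (r + (cumulative_reward \<tau> + U (Suc h) z')))"
    by (simp add: fun_eq_iff algebra_simps)
  also have "measure_pmf.expectation (rew h z) \<dots>
      = c * measure_pmf.expectation (rew h z) (\<lambda>r. r + (cumulative_reward \<tau> + U (Suc h) z'))"
    by simp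
  also have "\<dots> = c * (rp h z * cap h + U (Suc h) z') + c * cumulative_reward \<tau>"
    by (simp only: expectation_rew) (simp add: algebra_simps)
  also have "\<dots> \<le> c * U h z + c * cumulative_reward \<tau>" using inv' by simp
  finally have "measure_pmf.expectation (rollout ?M f (Suc k) \<tau> x) (\<lambda>t. c * cumulative_reward t)
      \<le> c * (cumulative_reward \<tau> + U h z)" by (simp add: algebra_simps)
  moreover have "finite (set_pmf (rollout ?M f (Suc k) \<tau> x))"
    unfolding eq rew using fin1 by auto
  ultimately show ?case by (simp add: z_def)
qed

lemma state_value_le:
  assumes "lay x = h" "1 \<le> h" "h \<le> H"
  shows "state_value (hard_mdp \<theta> \<sigma>) \<pi> h x \<le> Vopt h (type_of \<sigma> x)"
proof -
  have "measure_pmf.expectation (rollout (hard_mdp \<theta> \<sigma>) (\<lambda>_. \<pi>) (Suc H - h) [] x) (\<lambda>t. 1 * cumulative_reward t)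
      \<le> 1 * (cumulative_reward ([] :: (nat, bool) trajectory) + Vopt h (type_of \<sigma> x))"
    by (rule conjunct2, rule rollout_value[where I = "\<lambda>_ _. True" and A = "\<lambda>_ _. True"])
      (use assms bellman_le in \<open>auto simp: Vopt_def\<close>)
  then show ?thesis
    by (simp add: state_value_def rollout_from_def)
qed

lemma mem_total_states: "x \<in> total_states H X \<longleftrightarrow> lay x \<in> {1..H}"
  by (auto simp: total_states_def mem_X)

lemma pol_apply: "lay x \<in> {1..H} \<Longrightarrow> pol \<theta> x \<longleftrightarrow> lay x mod Suc n \<in> \<theta>"
  by (simp add: pol_def mem_total_states)

lemma state_value_pol:
  assumes "lay x = h" "1 \<le> h" "h \<le> H"
  shows "state_value (hard_mdp \<theta> \<sigma>) (pol \<theta>) h x = Vopt h (type_of \<sigma> x)"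
proof (rule antisym[OF state_value_le[OF assms]])
  have "measure_pmf.expectation (rollout (hard_mdp \<theta> \<sigma>) (\<lambda>_. pol \<theta>) (Suc H - h) [] x) (\<lambda>t. (-1) * cumulative_reward t)
      \<le> (-1) * (cumulative_reward ([] :: (nat, bool) trajectory) + Vopt h (type_of \<sigma> x))"
    by (rule conjunct2, rule rollout_value[where I = "\<lambda>_ _. True" and A = "\<lambda>h a. a = (h mod Suc n \<in> \<theta>)"])
      (use assms bellman_eq pol_apply in \<open>auto simp: Vopt_def\<close>)
  then show "Vopt h (type_of \<sigma> x) \<le> state_value (hard_mdp \<theta> \<sigma>) (pol \<theta>) h x"
    by (simp add: state_value_def rollout_from_def)
qed

text \<open>The first block pays nothing before its bump. A policy with some wrong bit therefore
  makes the initially live state null before any premium is paid, and only the value of a null state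
  remains.\<close>

lemma state_value_wrong_pol:
  assumes j: "j \<in> {1..n}" "(j \<in> \<theta>) \<noteq> (j \<in> \<theta>')" and x: "lay x = 1"
  shows "state_value (hard_mdp \<theta> \<sigma>) (pol \<theta>') 1 x \<le> Vopt 1 3"
proof -
  have lock: "lock h" "h mod Suc n = h" "\<not> bump h" "h \<noteq> H" if "1 \<le> h" "h \<le> j" for h
  proof -
    note block_le
    then have "h < H" "h \<le> m * Suc n" using that j H_large by auto
    then show "lock h" "h mod Suc n = h" "\<not> bump h" "h \<noteq> H" using that j by (auto simp: lock_def bump_def)
  qed
  have H: "1 \<le> H" using H_large by simp
  have "measure_pmf.expectation (rollout (hard_mdp \<theta> \<sigma>) (\<lambda>_. pol \<theta>') (Suc H - 1) [] x) (\<lambda>t. 1 * cumulative_reward t)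
      \<le> 1 * (cumulative_reward ([] :: (nat, bool) trajectory) + Vopt 1 3)"
  \<comment> \<open>The state may stay live up to layer \<open>j\<close>, where the wrong bit makes
    it null at the latest. As live and null states are paid alike up to there, the null value can
    serve as \<open>U\<close> throughout.\<close>
  proof (rule conjunct2, rule rollout_value[where I = "\<lambda>h z. z = 3 \<or> z = 0 \<and> h \<le> j"
        and A = "\<lambda>h a. a = (h mod Suc n \<in> \<theta>')" and U = "\<lambda>h _. Vopt h 3"])
    fix h a and z :: nat assume h: "1 \<le> h" "h \<le> H" and z: "z = 3 \<or> z = 0 \<and> h \<le> j" and a: "a = (h mod Suc n \<in> \<theta>')"
    have null: "rp h 3 * cap h + Vopt (Suc h) 3 \<le> Vopt h 3"
      using bellman_le[OF h, of 3 \<theta> a] by (simp add: step_null)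
    show "(step \<theta> h a z = 3 \<or> step \<theta> h a z = 0 \<and> Suc h \<le> j) \<and>
        1 * (rp h z * cap h + Vopt (Suc h) 3) \<le> 1 * Vopt h 3"
    proof (cases "z = 3")
      case True
      then show ?thesis using null by (simp add: step_null)
    next
      case False
      then have z0: "z = 0" "h \<le> j" using z by auto
      note l = lock[OF h(1) z0(2)]
      have "rp h z * cap h = rp h 3 * cap h" using l by (simp add: cap_def)
      moreover have "a = (h \<in> \<theta>) \<Longrightarrow> Suc h \<le> j" using a j l z0 by (cases "h = j") auto
      ultimately show ?thesis using null l z0 by (auto simp: step_def)
    qed
  next
    show "Vopt (Suc H) 3 = 0" by (simp add: Vopt_def)
  qed (use x j H pol_apply in \<open>auto simp: type_of_def\<close>)
  then show ?thesis
    by (simp add: state_value_def rollout_from_def)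
qed

text \<open>This gap exceeds \<open>1 / 8\<close>, so \<open>pol \<theta>\<close> is the only
  1/8-optimal member of the class and a correct output reveals the secret.\<close>

lemma Vopt_gap: "Vopt 1 0 - Vopt 1 3 = 3 / 16"
  using H_large q_one by (simp add: Vopt_def)

lemma policy_value_pol: "policy_value (hard_mdp \<theta> \<sigma>) (pol \<theta>) = Vopt 1 0"
proof -
  have "policy_value (hard_mdp \<theta> \<sigma>) (pol \<theta>)
      = (\<Sum>x\<in>X 1. state_value (hard_mdp \<theta> \<sigma>) (pol \<theta>) 1 x) / card (X 1)"
    by (simp add: policy_value_def hard_mdp_def integral_pmf_of_set)
  also have "\<dots> = (\<Sum>x\<in>X 1. Vopt 1 0) / card (X 1)"
    using H_large state_value_pol by (intro arg_cong2[where f = "(/)"] sum.cong) (auto simp: mem_X type_of_def)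
  finally show ?thesis using N_pos by (simp add: card_X)
qed

lemma policy_value_wrong_pol:
  assumes "\<theta> \<subseteq> {1..n}" "\<theta>' \<subseteq> {1..n}" "\<theta> \<noteq> \<theta>'"
  shows "policy_value (hard_mdp \<theta> \<sigma>) (pol \<theta>') \<le> Vopt 1 3"
proof -
  obtain j where j: "j \<in> {1..n}" "(j \<in> \<theta>) \<noteq> (j \<in> \<theta>')" using assms by blast
  have "policy_value (hard_mdp \<theta> \<sigma>) (pol \<theta>')
      = (\<Sum>x\<in>X 1. state_value (hard_mdp \<theta> \<sigma>) (pol \<theta>') 1 x) / card (X 1)"
    by (simp add: policy_value_def hard_mdp_def integral_pmf_of_set)
  also have "\<dots> \<le> (\<Sum>x\<in>X 1. Vopt 1 3) / card (X 1)"
    using state_value_wrong_pol[OF j] by (intro divide_right_mono sum_mono) (auto simp: mem_X)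
  finally show ?thesis using N_pos by (simp add: card_X)
qed

lemma eps_optimal_imp_eq:
  assumes "\<theta> \<subseteq> {1..n}" "\<pi> \<in> Pol" "eps_optimal Pol (hard_mdp \<theta> \<sigma>) (1 / 8) \<pi>"
  shows "\<pi> = pol \<theta>"
proof -
  obtain \<theta>' where \<theta>': "\<pi> = pol \<theta>'" "\<theta>' \<subseteq> {1..n}" using assms by (auto simp: Pol_def)
  have "finite Pol" by (simp add: Pol_def)
  then have "policy_value (hard_mdp \<theta> \<sigma>) (pol \<theta>) \<le> Max (policy_value (hard_mdp \<theta> \<sigma>) ` Pol)"
    using assms by (intro Max_ge) (auto simp: Pol_def)
  then have "Vopt 1 0 - 1 / 8 \<le> policy_value (hard_mdp \<theta> \<sigma>) (pol \<theta>')"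
    using assms \<theta>' by (simp add: eps_optimal_def policy_value_pol)
  then show ?thesis using policy_value_wrong_pol[OF assms(1) \<theta>'(2), of \<sigma>] Vopt_gap \<theta>' by force
qed

section \<open>Realizability, bounded rewards and concentrability\<close>

lemma finite_policies: "finite (policies H X :: (nat \<Rightarrow> bool) set)"
  unfolding policies_def by (intro finite_PiE) (auto simp: total_states_def)

lemma Pol_subset: "Pol \<subseteq> policies H X"
  by (auto simp: Pol_def pol_def policies_def)

lemma inj_pol: "inj_on pol (Pow {1..n})"
proof (rule inj_onI)
  fix \<theta> \<theta>' assume \<theta>: "\<theta> \<in> Pow {1..n}" "\<theta>' \<in> Pow {1..n}" and eq: "pol \<theta> = pol \<theta>'"
  have "j \<in> \<theta> \<longleftrightarrow> j \<in> \<theta>'" if j: "j \<in> {1..n}" for j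
  proof -
    note block_le
    then have jH: "j \<in> {1..H}" using j H_large by auto
    have "lay (4 * N * j) = j" using N_pos by (simp add: lay_def)
    then show ?thesis using fun_cong[OF eq, of "4 * N * j"] pol_apply[of "4 * N * j"] j jH by auto
  qed
  then show "\<theta> = \<theta>'" using \<theta> by blast
qed

lemma card_Pol: "card Pol = 2 ^ n"
  unfolding Pol_def card_image[OF inj_pol] by (simp add: card_Pow)

lemma realizable_hard_mdp:
  assumes "\<theta> \<subseteq> {1..n}"
  shows "realizable Pol (hard_mdp \<theta> \<sigma>)"
  unfolding realizable_def
proof (intro bexI ballI)
  show "pol \<theta> \<in> Pol" using assms by (simp add: Pol_def)
  fix h x assume "h \<in> {1..horizon (hard_mdp \<theta> \<sigma>)}" "x \<in> layer (hard_mdp \<theta> \<sigma>) h"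
  then have h: "lay x = h" "1 \<le> h" "h \<le> H" by (auto simp: hard_mdp_def mem_X)
  have "Max ((\<lambda>\<pi>'. state_value (hard_mdp \<theta> \<sigma>) \<pi>' h x) ` policies H X) = Vopt h (type_of \<sigma> x)"
  proof (rule Max_eqI)
    show "Vopt h (type_of \<sigma> x) \<in> (\<lambda>\<pi>'. state_value (hard_mdp \<theta> \<sigma>) \<pi>' h x) ` policies H X"
      using state_value_pol[OF h] Pol_subset assms by (intro image_eqI[of _ _ "pol \<theta>"]) (auto simp: Pol_def)
  qed (use finite_policies state_value_le[OF h] in auto)
  then show "state_value (hard_mdp \<theta> \<sigma>) (pol \<theta>) h x =
      Max ((\<lambda>\<pi>'. state_value (hard_mdp \<theta> \<sigma>) \<pi>' h x)
        ` policies (horizon (hard_mdp \<theta> \<sigma>)) (layer (hard_mdp \<theta> \<sigma>)))"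
    using state_value_pol[OF h] by (simp add: hard_mdp_def)
qed

lemma layered_X: "layered H X"
  by (auto simp: layered_def disjoint_family_on_def mem_X)

text \<open>A geometric series: at a bump, \<open>3 / 8 * q h\<close> is collected at most and
  \<open>q\<close> halves, so the bound \<open>3 / 4 * q h\<close> reproduces itself;
  \<open>1 / 4\<close> is reserved for the final layer.\<close>

lemma rewards_bounded:
  assumes "1 \<le> h" "h \<le> Suc H" "length \<tau> = Suc H - h"
    and "\<And>i. i < length \<tau> \<Longrightarrow> snd (snd (\<tau> ! i)) \<in> {0, cap (h + i)}"
  shows "0 \<le> cumulative_reward \<tau> \<and> (h \<le> H \<longrightarrow> cumulative_reward \<tau> \<le> 3 / 4 * q h + 1 / 4)"
  using assms
proof (induction \<tau> arbitrary: h)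
  case Nil
  then show ?case by (simp add: cumulative_reward_def)
next
  case (Cons y \<tau>)
  obtain x a r where y: "y = (x, a, r)" by (cases y)
  have r: "r = 0 \<or> r = cap h" using Cons.prems(4)[of 0] y by simp
  have "snd (snd (\<tau> ! i)) \<in> {0, cap (Suc h + i)}" if "i < length \<tau>" for i
    using Cons.prems(4)[of "Suc i"] that by simp
  then have IH: "0 \<le> cumulative_reward \<tau> \<and>
      (Suc h \<le> H \<longrightarrow> cumulative_reward \<tau> \<le> 3 / 4 * q (Suc h) + 1 / 4)"
    using Cons.prems by (intro Cons.IH) auto
  have cum: "cumulative_reward (y # \<tau>) = r + cumulative_reward \<tau>"
    by (simp add: y cumulative_reward_def)
  have "cumulative_reward (y # \<tau>) \<le> 3 / 4 * q h + 1 / 4" if "h \<le> H"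
  proof (cases "h = H")
    case True
    then have "\<tau> = []" using Cons.prems by simp
    then show ?thesis using cum r True q_pos[of H] by (auto simp: cumulative_reward_def cap_def)
  next
    case False
    then have "cumulative_reward \<tau> \<le> 3 / 4 * q (Suc h) + 1 / 4" using IH that by simp
    then show ?thesis
      using cum r False q_pos[of h] q_bump[of h] q_not_bump[of h] Cons.prems
      by (cases "bump h") (auto simp: cap_def)
  qed
  then show ?case using cum r IH cap_nonneg[of h] by auto
qed

lemma is_mdp_hard_mdp: "is_mdp (hard_mdp \<theta> \<sigma>)"
  unfolding is_mdp_def
proof (intro conjI ballI allI)
  let ?M = "hard_mdp \<theta> \<sigma>"
  show "1 \<le> horizon ?M" using H_large by (simp add: hard_mdp_def)
  show "layered (horizon ?M) (layer ?M)" using layered_X by (simp add: hard_mdp_def)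
  show "set_pmf (init ?M) \<subseteq> layer ?M 1" by (simp add: hard_mdp_def)
  fix h assume "h \<in> {1..<horizon ?M}"
  fix x a assume "x \<in> layer ?M h"
  then have "lay x = h" by (simp add: hard_mdp_def mem_X)
  then show "set_pmf (transition ?M x a) \<subseteq> layer ?M (Suc h)"
    using set_pmf_transition[of x \<theta> \<sigma> a] \<open>h \<in> _\<close> by (auto simp: hard_mdp_def cell_def)
next
  let ?M = "hard_mdp \<theta> \<sigma>"
  fix h \<tau> assume h: "h \<in> {1..horizon ?M}" and \<tau>: "\<tau> \<in> trajectories_from ?M h"
  have hH: "1 \<le> h" "h \<le> H" using h by (auto simp: hard_mdp_def)
  have "0 \<le> cumulative_reward \<tau> \<and> (h \<le> H \<longrightarrow> cumulative_reward \<tau> \<le> 3 / 4 * q h + 1 / 4)"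
  proof (rule rewards_bounded)
    show "length \<tau> = Suc H - h" using \<tau> by (simp add: trajectories_from_def hard_mdp_def)
    fix i assume "i < length \<tau>"
    moreover obtain x a r where y: "\<tau> ! i = (x, a, r)" by (cases "\<tau> ! i")
    ultimately have "r \<in> set_pmf (rew (h + i) (type_of \<sigma> x))"
      using \<tau> by (auto simp: trajectories_from_def hard_mdp_def mem_X)
    then show "snd (snd (\<tau> ! i)) \<in> {0, cap (h + i)}"
      using set_pmf_rew[of "h + i" "type_of \<sigma> x"] y by auto
  qed (use hH in auto)
  moreover have "q h \<le> 1" by (simp add: q_def power_le_one)
  ultimately show "cumulative_reward \<tau> \<in> {0..1}" using hH by auto
qed

lemma C_push_hard_mdp: "C_push reset_dist (hard_mdp \<theta> \<sigma>) \<le> 8"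
  unfolding C_push_def
proof (intro SUP_least)
  let ?M = "hard_mdp \<theta> \<sigma>"
  fix h x a assume h: "h \<in> {1..<horizon ?M}" and "x \<in> layer ?M h"
  then have lx: "lay x = h" "1 \<le> h" by (auto simp: hard_mdp_def mem_X)
  show "linf_ratio (layer ?M (Suc h)) (transition ?M x a) (reset_dist (Suc h)) \<le> 8"
    unfolding linf_ratio_def
  proof (rule Inf_lower, clarify)
    fix x' assume "x' \<in> layer ?M (Suc h)"
    then have x': "x' \<in> X (Suc h)" by (simp add: hard_mdp_def)
    define C where "C = cell \<sigma> (Suc h) (step \<theta> h a (type_of \<sigma> x))"
    have C: "card C = N" "C \<noteq> {}" "finite C"
      using lx by (auto simp: C_def card_cell cell_nonempty step_less type_of_less)
    have "pmf (transition ?M x a) x' = indicator C x' / N"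
      using C lx by (simp add: hard_mdp_def C_def[symmetric])
    \<comment> \<open>A cell holds a quarter of the states of its layer, so the ratio is in fact
      4.\<close>
    also have "\<dots> \<le> 8 * pmf (reset_dist (Suc h)) x'"
      using x' N_pos by (auto simp: reset_dist_def card_X field_simps split: split_indicator)
    finally have "ennreal (pmf (transition ?M x a) x') \<le> ennreal (8 * pmf (reset_dist (Suc h)) x')"
      by (rule ennreal_leI)
    then show "ennreal (pmf (transition ?M x a) x') \<le> 8 * ennreal (pmf (reset_dist (Suc h)) x')"
      by (simp add: ennreal_mult)
  qed
qed

end

section \<open>Averaging over the offsets\<close>

context lock_family
begin

section \<open>Likelihoods given the types, keys and secrets\<close>

primrec layered_traj :: "nat \<Rightarrow> (nat, bool) trajectory \<Rightarrow> bool" where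
  "layered_traj h [] \<longleftrightarrow> h = Suc H"
| "layered_traj h (y # ys) \<longleftrightarrow> lay (fst y) = h \<and> h \<le> H \<and> layered_traj (Suc h) ys"

text \<open>The types evolve deterministically given the actions, so only the rewards contribute.\<close>

primrec type_lik :: "nat set \<Rightarrow> nat \<Rightarrow> nat \<Rightarrow> (nat, bool) trajectory \<Rightarrow> real" where
  "type_lik \<theta> h z [] = 1"
| "type_lik \<theta> h z (y # ys) =
     pmf (rew h z) (snd (snd y)) * type_lik \<theta> (Suc h) (step \<theta> h (fst (snd y)) z) ys"

text \<open>A key is the index of the offset that hides the type of a state; four states share each
  key.\<close>

definition keys :: "(nat, bool) trajectory \<Rightarrow> nat list" where
  "keys ys = map (\<lambda>y. fst y div 4) ys"

definition secrets :: "(nat \<Rightarrow> nat) set" where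
  "secrets = ({..<N * Suc H} \<rightarrow>\<^sub>E {..<4})"

text \<open>Layer \<open>b * Suc n + j\<close> sits at position \<open>b * Suc n + j - h\<close>.
  Only blocks traversed from their first lock layer on count: in a block entered later, the average
  over the types of the starting state already hides the payment at the bump.\<close>

definition matched :: "nat set \<Rightarrow> nat \<Rightarrow> (nat, bool) trajectory \<Rightarrow> bool" where
  "matched \<theta> h ys \<longleftrightarrow> (\<exists>b<m. h \<le> Suc (b * Suc n) \<and>
     (\<forall>j\<in>{1..n}. fst (snd (ys ! (b * Suc n + j - h))) = (j \<in> \<theta>)))"

lemma keys_Nil [simp]: "keys [] = []" and keys_Cons [simp]: "keys (y # ys) = fst y div 4 # keys ys"
  by (simp_all add: keys_def)

lemma card_secrets_pos: "0 < card secrets"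
  unfolding secrets_def by (simp add: card_PiE)

lemma layered_traj_length: "layered_traj h ys \<Longrightarrow> length ys = Suc H - h \<and> h \<le> Suc H"
  by (induction ys arbitrary: h) auto

lemma layered_traj_ne: "layered_traj h ys \<Longrightarrow> h \<le> H \<Longrightarrow> ys \<noteq> [] \<and> lay (fst (hd ys)) = h"
  by (cases ys) auto

lemma type_lik_nonneg: "0 \<le> type_lik \<theta> h z ys"
  by (induction ys arbitrary: h z) auto

lemma pmf_transition:
  assumes "lay x = h" "1 \<le> h" "lay x' = Suc h"
  shows "pmf (transition (hard_mdp \<theta> \<sigma>) x a) x'
    = of_bool (type_of \<sigma> x' = step \<theta> h a (type_of \<sigma> x)) / N"
proof -
  define C where "C = cell \<sigma> (Suc h) (step \<theta> h a (type_of \<sigma> x))"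
  have "C \<noteq> {}" "card C = N" "finite C"
    using assms by (auto simp: C_def cell_nonempty card_cell step_less type_of_less)
  moreover have "x' \<in> C \<longleftrightarrow> type_of \<sigma> x' = step \<theta> h a (type_of \<sigma> x)"
    using assms by (simp add: C_def cell_def mem_X)
  ultimately show ?thesis using assms
    by (simp add: hard_mdp_def C_def[symmetric] indicator_def)
qed

lemma traj_weight_hard_Cons:
  assumes "layered_traj h (y # ys)" "1 \<le> h"
  shows "traj_weight (hard_mdp \<theta> \<sigma>) (y # ys) =
    pmf (rew h (type_of \<sigma> (fst y))) (snd (snd y)) * (if ys = [] then 1 else
      of_bool (type_of \<sigma> (fst (hd ys)) = step \<theta> h (fst (snd y)) (type_of \<sigma> (fst y))) / N
        * traj_weight (hard_mdp \<theta> \<sigma>) ys)"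
proof -
  obtain x a r where y: "y = (x, a, r)" by (cases y)
  have x: "lay x = h" using assms y by simp
  have "lay (fst (hd ys)) = Suc h" if "ys \<noteq> []" using that assms by (cases ys) auto
  then show ?thesis using pmf_transition[OF x assms(2)] x
    by (auto simp: y traj_weight_Cons) (simp_all add: hard_mdp_def)
qed

section \<open>Independent uniform offsets\<close>

lemma type_of_upd: "x div 4 \<noteq> k \<Longrightarrow> type_of (\<sigma>(k := v)) x = type_of \<sigma> x"
  by (simp add: type_of_def)

lemma traj_weight_hard_upd:
  assumes "layered_traj h ys" "1 \<le> h" "k \<notin> set (keys ys)"
  shows "traj_weight (hard_mdp \<theta> (\<sigma>(k := v))) ys = traj_weight (hard_mdp \<theta> \<sigma>) ys"
  using assms
proof (induction ys arbitrary: h)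
  case (Cons y ys)
  have "type_of (\<sigma>(k := v)) (fst (hd ys)) = type_of \<sigma> (fst (hd ys))" if "ys \<noteq> []"
    using that Cons.prems by (cases ys) (auto simp: type_of_upd)
  then show ?case
    using Cons.IH[of "Suc h"] Cons.prems
    by (simp add: traj_weight_hard_Cons[OF Cons.prems(1,2)] type_of_upd del: fun_upd_apply)
qed simp

lemma sum_lessThan_4: "(\<Sum>z<4. F z) = F 0 + F 1 + F 2 + F 3" for F :: "nat \<Rightarrow> real"
  by (simp add: numeral_eq_Suc)

text \<open>A uniform offset makes the type of \<open>x\<close> uniform, independently of any
  quantity \<open>G\<close> that ignores this offset.\<close>

lemma sum_type_of:
  assumes G: "\<And>\<sigma> v. G (\<sigma>(x div 4 := v)) = (G \<sigma> :: real)"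
    and x: "lay x \<noteq> 1" "lay x \<le> H" and z: "z < 4"
  shows "(\<Sum>\<sigma>\<in>secrets. of_bool (type_of \<sigma> x = z) * G \<sigma>) = (\<Sum>\<sigma>\<in>secrets. G \<sigma>) / 4"
proof -
  define k where "k = x div 4"
  define D where "D = {..<N * Suc H} - {k}"
  have "k < N * Suc H"
    using x N_pos by (simp add: lay_key k_def div_le_mono less_Suc_eq_le[symmetric] div_less_iff_less_mult mult.commute)
  then have ins: "insert k D = {..<N * Suc H}" by (auto simp: D_def)
  define P where "P = (D \<rightarrow>\<^sub>E {..<4::nat})"
  have sec: "secrets = (\<lambda>(y, g). g(k := y)) ` ({..<4} \<times> P)"
    unfolding secrets_def ins[symmetric] P_def by (rule PiE_insert_eq)
  have inj: "inj_on (\<lambda>(y, g). g(k := y)) ({..<4} \<times> P)"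
    unfolding P_def by (rule inj_combinator) (simp add: D_def)
  have split: "(\<Sum>\<sigma>\<in>secrets. F \<sigma>) = (\<Sum>g\<in>P. \<Sum>y<4. F (g(k := y)))" for F :: "(nat \<Rightarrow> nat) \<Rightarrow> real"
  proof -
    have "(\<Sum>\<sigma>\<in>secrets. F \<sigma>) = (\<Sum>(y, g)\<in>{..<4} \<times> P. F (g(k := y)))"
      unfolding sec by (subst sum.reindex[OF inj]) (simp add: o_def case_prod_unfold)
    also have "\<dots> = (\<Sum>y<4. \<Sum>g\<in>P. F (g(k := y)))" by (rule sum.cartesian_product[symmetric])
    also have "\<dots> = (\<Sum>g\<in>P. \<Sum>y<4. F (g(k := y)))" by (rule sum.swap)
    finally show ?thesis .
  qed
  \<comment> \<open>For a given state, exactly one of the four offsets produces the type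
    \<open>z\<close>.\<close>
  have one: "(\<Sum>y<4. of_bool ((x + y) mod 4 = z) :: real) = 1"
  proof -
    have "x mod 4 < 4" by simp
    then have "x mod 4 \<in> {0, 1, 2, 3}" by auto
    moreover have "z \<in> {0, 1, 2, 3}" using z by auto
    ultimately have "(\<Sum>y<4. of_bool ((x mod 4 + y) mod 4 = z) :: real) = 1"
      by (auto simp: sum_lessThan_4 dest: dvd_imp_le)
    then show ?thesis by (simp only: mod_add_left_eq)
  qed
  have "(\<Sum>\<sigma>\<in>secrets. of_bool (type_of \<sigma> x = z) * G \<sigma>)
      = (\<Sum>g\<in>P. \<Sum>y<4. of_bool ((x + y) mod 4 = z) * G g)"
    unfolding split using x G by (simp add: type_of_def k_def[symmetric])
  also have "\<dots> = (\<Sum>g\<in>P. G g)"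
    by (simp add: sum_distrib_right[symmetric] one)
  also have "\<dots> = (\<Sum>\<sigma>\<in>secrets. G \<sigma>) / 4"
    unfolding split using G by (simp add: k_def[symmetric] sum_distrib_left[symmetric])
  finally show ?thesis .
qed

text \<open>Along a trajectory with distinct keys each transition has probability
  \<open>1 / N\<close> inside its cell, and the successor has the required type with probability
  \<open>1 / 4\<close>. Together this is the uniform probability \<open>1 / (4 * N)\<close>, and
  only the rewards retain information. \<open>G\<close> stands for the other trajectories of a
  history.\<close>

lemma sum_traj_weight_type:
  assumes "layered_traj h ys" "2 \<le> h" "h \<le> H" "z < 4" "distinct (keys ys)"
    and "\<And>k \<sigma> v. k \<in> set (keys ys) \<Longrightarrow> G (\<sigma>(k := v)) = (G \<sigma> :: real)"
  shows "(\<Sum>\<sigma>\<in>secrets. of_bool (type_of \<sigma> (fst (hd ys)) = z) * (traj_weight (hard_mdp \<theta> \<sigma>) ys * G \<sigma>))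
    = (1 / (4 * N)) ^ (length ys - 1) * type_lik \<theta> h z ys * ((\<Sum>\<sigma>\<in>secrets. G \<sigma>) / 4)"
  using assms
proof (induction ys arbitrary: h z G)
  case Nil
  then show ?case by simp
next
  case (Cons y ys)
  obtain x a r where y: "y = (x, a, r)" by (cases y)
  have x: "lay x = h" and lys: "layered_traj (Suc h) ys" using Cons.prems y by auto
  have base: "(\<Sum>\<sigma>\<in>secrets. of_bool (type_of \<sigma> x = z) * G \<sigma>) = (\<Sum>\<sigma>\<in>secrets. G \<sigma>) / 4"
  proof (rule sum_type_of)
    show "G (\<sigma>(x div 4 := v)) = G \<sigma>" for \<sigma> v by (rule Cons.prems(6)) (simp add: y)
  qed (use Cons.prems x in auto)
  show ?case
  proof (cases "ys = []")
    case True
    have "(\<Sum>\<sigma>\<in>secrets. of_bool (type_of \<sigma> x = z) * (traj_weight (hard_mdp \<theta> \<sigma>) (y # ys) * G \<sigma>))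
        = pmf (rew h z) r * (\<Sum>\<sigma>\<in>secrets. of_bool (type_of \<sigma> x = z) * G \<sigma>)"
      unfolding sum_distrib_left using traj_weight_hard_Cons[OF Cons.prems(1)] Cons.prems(2) True y
      by (intro sum.cong) auto
    then show ?thesis using base True y by simp
  next
    case False
    define z' where "z' = step \<theta> h a z"
    \<comment> \<open>The event that the present state has type \<open>z\<close> is moved into
      \<open>G\<close>: its key does not recur in \<open>ys\<close>, so the hypothesis on
      \<open>G\<close> persists.\<close>
    define G' where "G' = (\<lambda>\<sigma>. of_bool (type_of \<sigma> x = z) * G \<sigma>)"
    have hH: "Suc h \<le> H" using lys False by (cases ys) auto
    have G': "G' (\<sigma>(k := v)) = G' \<sigma>" if "k \<in> set (keys ys)" for k \<sigma> v
    proof -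
      have "G (\<sigma>(k := v)) = G \<sigma>" by (rule Cons.prems(6)) (use that in \<open>simp add: y\<close>)
      moreover have "type_of (\<sigma>(k := v)) x = type_of \<sigma> x"
        using that Cons.prems(5) by (intro type_of_upd) (auto simp: y)
      ultimately show ?thesis by (simp only: G'_def)
    qed
    have IH: "(\<Sum>\<sigma>\<in>secrets. of_bool (type_of \<sigma> (fst (hd ys)) = z') * (traj_weight (hard_mdp \<theta> \<sigma>) ys * G' \<sigma>))
      = (1 / (4 * N)) ^ (length ys - 1) * type_lik \<theta> (Suc h) z' ys * ((\<Sum>\<sigma>\<in>secrets. G' \<sigma>) / 4)"
    proof (rule Cons.IH)
      show "G' (\<sigma>(k := v)) = G' \<sigma>" if "k \<in> set (keys ys)" for k \<sigma> v using G'[OF that] .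
    qed (use Cons.prems hH lys in \<open>auto simp: z'_def step_less\<close>)
    have "(\<Sum>\<sigma>\<in>secrets. of_bool (type_of \<sigma> x = z) * (traj_weight (hard_mdp \<theta> \<sigma>) (y # ys) * G \<sigma>))
        = pmf (rew h z) r / N *
          (\<Sum>\<sigma>\<in>secrets. of_bool (type_of \<sigma> (fst (hd ys)) = z') * (traj_weight (hard_mdp \<theta> \<sigma>) ys * G' \<sigma>))"
      unfolding sum_distrib_left using traj_weight_hard_Cons[OF Cons.prems(1)] Cons.prems(2) False y
      by (intro sum.cong) (auto simp: z'_def G'_def)
    \<comment> \<open>One quarter is for the type of the present state, one for that of its
      successor; the latter joins \<open>1 / N\<close> to form the factor of this
      transition.\<close>
    also have "\<dots> = pmf (rew h z) r / N *
        ((1 / (4 * N)) ^ (length ys - 1) * type_lik \<theta> (Suc h) z' ys * ((\<Sum>\<sigma>\<in>secrets. G \<sigma>) / 4 / 4))"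
      unfolding IH unfolding G'_def base ..
    also have "\<dots> = (1 / (4 * N)) ^ (length (y # ys) - 1) * type_lik \<theta> h z (y # ys) * ((\<Sum>\<sigma>\<in>secrets. G \<sigma>) / 4)"
      using False y by (cases "length ys") (auto simp: z'_def mult_ac)
    finally show ?thesis by (simp add: y)
  qed
qed

text \<open>Reward likelihood averaged over the type of the first state: certainly live in layer 1,
  uniform over the four types in any other layer.\<close>

definition mean_lik :: "nat set \<Rightarrow> nat \<Rightarrow> (nat, bool) trajectory \<Rightarrow> real" where
  "mean_lik \<theta> h ys = (if h = 1 then type_lik \<theta> 1 0 ys else (\<Sum>z<4. type_lik \<theta> h z ys) / 4)"

text \<open>The state probabilities agree with those of the null process, which reduces the
  comparison to \<open>mean_lik\<close> against the likelihood of type 3.\<close>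

lemma sum_traj_weight:
  assumes ys: "layered_traj h ys" "1 \<le> h" "h \<le> H" "distinct (keys ys)"
    and G: "\<And>k \<sigma> v. k \<in> set (keys ys) \<Longrightarrow> G (\<sigma>(k := v)) = (G \<sigma> :: real)"
  shows "(\<Sum>\<sigma>\<in>secrets. traj_weight (hard_mdp \<theta> \<sigma>) ys * G \<sigma>)
    = (1 / (4 * N)) ^ (length ys - 1) * mean_lik \<theta> h ys * (\<Sum>\<sigma>\<in>secrets. G \<sigma>)"
proof (cases "h = 1")
  case False
  let ?F = "\<lambda>\<sigma>. traj_weight (hard_mdp \<theta> \<sigma>) ys * G \<sigma>"
  have one: "(\<Sum>z<4. of_bool (type_of \<sigma> x = z) :: real) = 1" for \<sigma> x
    using type_of_less[of \<sigma> x] by (simp add: of_bool_def)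
  have "(\<Sum>\<sigma>\<in>secrets. ?F \<sigma>) = (\<Sum>\<sigma>\<in>secrets. (\<Sum>z<4. of_bool (type_of \<sigma> (fst (hd ys)) = z)) * ?F \<sigma>)"
    unfolding one by simp
  also have "\<dots> = (\<Sum>\<sigma>\<in>secrets. \<Sum>z<4. of_bool (type_of \<sigma> (fst (hd ys)) = z) * ?F \<sigma>)"
    by (simp only: sum_distrib_right)
  also have "\<dots> = (\<Sum>z<4. \<Sum>\<sigma>\<in>secrets. of_bool (type_of \<sigma> (fst (hd ys)) = z) * ?F \<sigma>)"
    by (rule sum.swap)
  also have "\<dots> = (\<Sum>z<4. (1 / (4 * N)) ^ (length ys - 1) * type_lik \<theta> h z ys * ((\<Sum>\<sigma>\<in>secrets. G \<sigma>) / 4))"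
    using False ys G by (intro sum.cong sum_traj_weight_type) auto
  also have "\<dots> = (1 / (4 * N)) ^ (length ys - 1) * mean_lik \<theta> h ys * (\<Sum>\<sigma>\<in>secrets. G \<sigma>)"
    using False by (simp add: mean_lik_def sum_distrib_right[symmetric] sum_distrib_left[symmetric]
        sum_divide_distrib[symmetric])
  finally show ?thesis .
next
  case h: True
  have H2: "2 \<le> H" using H_large block_le n_pos by simp
  obtain y ys' where y: "ys = y # ys'" using layered_traj_ne[OF ys(1,3)] by (cases ys) auto
  obtain x a r where xar: "y = (x, a, r)" by (cases y)
  \<comment> \<open>In layer 1 the type does not involve the offset, so the first step is split off
    and the averaging starts with the state in layer 2.\<close>
  have lys: "layered_traj 2 ys'" and x: "lay x = 1" using ys y h xar by (auto simp: numeral_2_eq_2)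
  have ne: "ys' \<noteq> []" using layered_traj_ne[OF lys H2] by simp
  define z' where "z' = step \<theta> 1 a 0"
  have tx: "type_of \<sigma> x = 0" for \<sigma> using x by (simp add: type_of_def)
  have "(\<Sum>\<sigma>\<in>secrets. traj_weight (hard_mdp \<theta> \<sigma>) ys * G \<sigma>)
      = pmf (rew 1 0) r / N * (\<Sum>\<sigma>\<in>secrets. of_bool (type_of \<sigma> (fst (hd ys')) = z')
          * (traj_weight (hard_mdp \<theta> \<sigma>) ys' * G \<sigma>))"
    unfolding sum_distrib_left y using traj_weight_hard_Cons[of 1 y ys'] ys h y ne
    by (intro sum.cong) (auto simp: z'_def xar tx)
  also have "(\<Sum>\<sigma>\<in>secrets. of_bool (type_of \<sigma> (fst (hd ys')) = z') * (traj_weight (hard_mdp \<theta> \<sigma>) ys' * G \<sigma>))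
      = (1 / (4 * N)) ^ (length ys' - 1) * type_lik \<theta> 2 z' ys' * ((\<Sum>\<sigma>\<in>secrets. G \<sigma>) / 4)"
    using ys lys H2 G y by (intro sum_traj_weight_type) (auto simp: z'_def step_less)
  also have "pmf (rew 1 0) r / N * \<dots>
      = (1 / (4 * N)) ^ (length ys - 1) * mean_lik \<theta> h ys * (\<Sum>\<sigma>\<in>secrets. G \<sigma>)"
    using ne y h by (cases "length ys'") (auto simp: z'_def mean_lik_def xar numeral_2_eq_2 mult_ac)
  finally show ?thesis .
qed

text \<open>Type 3 is absorbing under every action and every secret, so \<open>\<theta>\<close> is
  arbitrary here and can be matched with that of a hard MDP.\<close>

lemma traj_weight_null:
  assumes "layered_traj h ys"
  shows "traj_weight null_mdp ys = (1 / (4 * N)) ^ (length ys - 1) * type_lik \<theta> h 3 ys"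
  using assms
proof (induction ys arbitrary: h)
  case (Cons y ys)
  obtain x a r where y: "y = (x, a, r)" by (cases y)
  have "lay (fst (hd ys)) = Suc h" if "ys \<noteq> []" using that Cons.prems by (cases ys) auto
  then show ?case using Cons y
    by (cases "length ys") (auto simp: traj_weight_Cons null_mdp_def step_null card_X mem_X indicator_def)
qed simp

section \<open>Comparison with the likelihood of a null state\<close>

lemma matched_tail: "matched \<theta> (Suc h) ys \<Longrightarrow> matched \<theta> h (y # ys)"
proof -
  assume "matched \<theta> (Suc h) ys"
  then obtain b where b: "b < m" "Suc h \<le> Suc (b * Suc n)"
    "\<And>j. j \<in> {1..n} \<Longrightarrow> fst (snd (ys ! (b * Suc n + j - Suc h))) = (j \<in> \<theta>)"
    by (auto simp: matched_def)
  have "b * Suc n + j - h = Suc (b * Suc n + j - Suc h)" if "j \<in> {1..n}" for j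
    using that b(2) by (auto simp: Suc_diff_le)
  then show ?thesis using b unfolding matched_def by (intro exI[of _ b]) (auto simp del: mult_Suc_right)
qed

text \<open>Lock layers pay nothing. A live state that meets a wrong action at position
  \<open>j\<close> of its block is null before the bump and leaves no trace of having been
  live.\<close>

lemma type_lik_live_mismatch:
  assumes "layered_traj h ys" "h = b * Suc n + i" "1 \<le> i" "i \<le> n" "b < m" "i \<le> j" "j \<le> n"
    and "fst (snd (ys ! (j - i))) \<noteq> (j \<in> \<theta>)"
  shows "type_lik \<theta> h 0 ys = type_lik \<theta> h 3 ys"
  using assms
proof (induction ys arbitrary: h i)
  case (Cons y ys)
  have "Suc b * Suc n \<le> m * Suc n" using Cons.prems by (intro mult_le_mono1) simp
  then have hm: "h < m * Suc n" using Cons.prems by simp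
  have i: "h mod Suc n = i" using Cons.prems by (simp only: mod_mult_self3) simp
  have lock: "lock h" "\<not> bump h" "h \<noteq> H" using hm i Cons.prems H_large by (auto simp: lock_def bump_def)
  have rew: "rew h 0 = rew h 3" using lock by (simp add: rew_def rp_def)
  show ?case
  proof (cases "fst (snd y) = (i \<in> \<theta>)")
    case False
    then show ?thesis using rew lock i by (simp add: step_def)
  next
    case True
    then have "i \<noteq> j" using Cons.prems by auto
    then have "type_lik \<theta> (Suc h) 0 ys = type_lik \<theta> (Suc h) 3 ys"
      using Cons.prems by (intro Cons.IH[of _ "Suc i"]) (auto simp: Suc_diff_le nth_Cons')
    then show ?thesis using True rew lock i by (simp add: step_def)
  qed
qed simp

text \<open>Live and null differ only in the final layer. There a null state never pays and a live
  one stays silent with probability \<open>1 - leak\<close>, so only the silent outcome has to be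
  compared.\<close>

lemma type_lik_live_filler:
  assumes "layered_traj h ys" "m * Suc n < h"
  shows "(1 - leak) * type_lik \<theta> h 3 ys \<le> type_lik \<theta> h 0 ys"
  using assms
proof (induction ys arbitrary: h)
  case (Cons y ys)
  have st: "step \<theta> h a z = z" for a z using Cons.prems by (simp add: step_def lock_def bump_def)
  show ?case
  proof (cases "h = H")
    case True
    then have "ys = []" using Cons.prems by (cases ys) auto
    then show ?thesis using True leak_bounds
      by (auto simp: pmf_rew rp_def cap_def of_bool_def)
  next
    case False
    then have "rew h 0 = rew h 3" using Cons.prems by (simp add: rew_def rp_def bump_def)
    then show ?thesis using Cons.IH[of "Suc h"] Cons.prems st
      by (simp add: mult.left_commute[of "1 - leak"] mult_left_mono)
  qed
qed (use leak_bounds in simp)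

text \<open>From a block start, an unmatched block destroys the live type before its bump; past the
  last block only the final leak remains.\<close>

lemma type_lik_live_block_start:
  assumes "layered_traj h ys" "\<not> matched \<theta> h ys" "h mod Suc n = 1 \<or> m * Suc n < h"
  shows "(1 - leak) * type_lik \<theta> h 3 ys \<le> type_lik \<theta> h 0 ys"
proof (cases "m * Suc n < h")
  case True
  then show ?thesis using assms by (intro type_lik_live_filler)
next
  case False
  define b where "b = h div Suc n"
  have h: "h = b * Suc n + 1" using assms False div_mult_mod_eq[of h "Suc n"] by (simp add: b_def)
  then have "b * Suc n < m * Suc n" using False by simp
  then have b: "b < m" by (simp only: mult_less_cancel2)
  have "\<not> (\<forall>j\<in>{1..n}. fst (snd (ys ! (b * Suc n + j - h))) = (j \<in> \<theta>))"
    using assms(2) b h unfolding matched_def by (metis Suc_eq_plus1 order_refl)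
  then obtain j where j: "j \<in> {1..n}" "fst (snd (ys ! (b * Suc n + j - h))) \<noteq> (j \<in> \<theta>)"
    by blast
  have "type_lik \<theta> h 0 ys = type_lik \<theta> h 3 ys"
    using assms(1) h b j n_pos by (intro type_lik_live_mismatch[of _ _ b 1 j]) auto
  then show ?thesis using leak_bounds type_lik_nonneg[of \<theta> h 3 ys] by (simp add: mult_left_le_one_le)
qed

text \<open>Up to the first wrong action or bump all four types behave alike. A wrong lock action
  makes them all null. At a bump the payments average to the null payment, live and null become
  null, and the dead types become live at a block start, where they look null up to the factor
  \<open>1 - leak\<close>. That factor is thus lost at most once per trajectory.\<close>

lemma sum_type_lik:
  assumes "layered_traj h ys" "1 \<le> h" "\<not> matched \<theta> h ys"
  shows "4 * ((1 - leak) * type_lik \<theta> h 3 ys) \<le> (\<Sum>z<4. type_lik \<theta> h z ys)"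
  using assms
proof (induction ys arbitrary: h)
  case Nil
  then show ?case using leak_bounds by simp
next
  case (Cons y ys)
  obtain x a r where y: "y = (x, a, r)" by (cases y)

  have lys: "layered_traj (Suc h) ys" using Cons.prems by simp
  have nm: "\<not> matched \<theta> (Suc h) ys" using Cons.prems matched_tail by blast
  note IH = Cons.IH[OF lys _ nm]
  have null: "(1 - leak) * type_lik \<theta> h 3 (y # ys) \<le> type_lik \<theta> h 3 (y # ys)"
    using leak_bounds type_lik_nonneg[of \<theta> h 3 "y # ys"] by (intro mult_left_le_one_le) auto
  consider "h = H" | "h \<noteq> H" "bump h" | "h \<noteq> H" "\<not> bump h" by blast
  then show ?case
  proof cases
    case 1
    have st: "step \<theta> h a z = z" for z using 1 H_large by (simp add: step_def lock_def bump_def)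
    have ys: "ys = []" using 1 lys by (cases ys) auto
    have "(1 - leak) * type_lik \<theta> h 3 (y # ys) \<le> type_lik \<theta> h 0 (y # ys)"
      using Cons.prems 1 H_large by (intro type_lik_live_filler) auto
    moreover have "type_lik \<theta> h z (y # ys) = type_lik \<theta> h 3 (y # ys)" if "z \<noteq> 0" for z
      using that 1 ys by (simp add: rew_def rp_def)
    from this[of 1] this[of 2] have "type_lik \<theta> h 1 (y # ys) = type_lik \<theta> h 3 (y # ys)"
      "type_lik \<theta> h 2 (y # ys) = type_lik \<theta> h 3 (y # ys)" by simp_all
    ultimately show ?thesis using null unfolding sum_lessThan_4 by linarith
  next
    case 2
    have "h mod Suc n = 0" "h \<le> m * Suc n" using 2 by (auto simp: bump_def)
    then have "Suc h mod Suc n = 1" using n_pos by (simp add: mod_Suc)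
    then have live: "(1 - leak) * type_lik \<theta> (Suc h) 3 ys \<le> type_lik \<theta> (Suc h) 0 ys"
      using lys nm by (intro type_lik_live_block_start) auto
    have st: "step \<theta> h a z = (if z = 1 \<or> z = 2 then 0 else 3)" for z
      using 2 by (simp add: step_def lock_def bump_def)
    have pr: "pmf (rew h 3) r = (pmf (rew h 0) r + pmf (rew h 1) r + pmf (rew h 2) r + pmf (rew h 3) r) / 4"
      "pmf (rew h 2) r = pmf (rew h 1) r" "pmf (rew h 3) r = (of_bool (r = cap h) + of_bool (r = 0)) / 2"
      "pmf (rew h 0) r = of_bool (r = cap h)"
      using 2 by (simp_all add: pmf_rew rp_def)
    \<comment> \<open>The averaging identity, solved for the joint weight of the two dead
      types.\<close>
    have p1: "2 * pmf (rew h 1) r = 3 * pmf (rew h 3) r - pmf (rew h 0) r"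
    proof -
      have "2 * b = 3 * d - a" if "d = (a + b + c + d) / 4" "c = b" for a b c d :: real
        using that by (simp add: field_simps)
      from this[OF pr(1,2)] show ?thesis .
    qed
    define A where "A = type_lik \<theta> (Suc h) 3 ys"
    define B where "B = type_lik \<theta> (Suc h) 0 ys"
    have AB: "0 \<le> A" "(1 - leak) * A \<le> B" using live type_lik_nonneg by (auto simp: A_def B_def)
    \<comment> \<open>After the bump, live and null continue with the null likelihood
      \<open>A\<close>, the two dead types with the live likelihood \<open>B\<close>.\<close>
    have e: "(\<Sum>z<4. type_lik \<theta> h z (y # ys))
        = (pmf (rew h 0) r + pmf (rew h 3) r) * A + 2 * pmf (rew h 1) r * B"
      using pr(2) by (simp add: sum_lessThan_4 y st A_def B_def algebra_simps)
    have "4 * ((1 - leak) * type_lik \<theta> h 3 (y # ys))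
        = (pmf (rew h 0) r + pmf (rew h 3) r) * ((1 - leak) * A) + 2 * pmf (rew h 1) r * ((1 - leak) * A)"
      unfolding p1 by (simp add: y st A_def algebra_simps)
    also have "\<dots> \<le> (pmf (rew h 0) r + pmf (rew h 3) r) * A + 2 * pmf (rew h 1) r * B"
      using AB leak_bounds by (intro add_mono mult_left_mono mult_left_le_one_le) auto
    finally show ?thesis unfolding e .
  next
    case 3
    have rew: "rew h z = rew h 3" for z using 3 by (simp add: rew_def rp_def)
    show ?thesis
    proof (cases "lock h \<and> a \<noteq> (h mod Suc n \<in> \<theta>)")
      case True
      then have "type_lik \<theta> h z (y # ys) = type_lik \<theta> h 3 (y # ys)" for z
        using rew[of z] by (simp add: y step_def)
      from this[of 0] this[of 1] this[of 2]
      show ?thesis using null unfolding sum_lessThan_4 by linarith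
    next
      case False
      then have st: "step \<theta> h a z = z" for z using 3 by (simp add: step_def)
      have "4 * ((1 - leak) * type_lik \<theta> h 3 (y # ys))
          = pmf (rew h 3) r * (4 * ((1 - leak) * type_lik \<theta> (Suc h) 3 ys))"
        by (simp add: y st)
      also have "\<dots> \<le> pmf (rew h 3) r * (\<Sum>z<4. type_lik \<theta> (Suc h) z ys)"
        using IH by (intro mult_left_mono) auto
      also have "\<dots> = (\<Sum>z<4. type_lik \<theta> h z (y # ys))"
        unfolding sum_distrib_left
      proof (rule sum.cong[OF refl])
        fix z show "pmf (rew h 3) r * type_lik \<theta> (Suc h) z ys = type_lik \<theta> h z (y # ys)"
          using rew[of z] by (simp add: y st)
      qed
      finally show ?thesis .
    qed
  qed
qed

text \<open>A start in layer 1 is live but at a block start; any other start is covered by the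
  average over the types.\<close>

lemma mean_lik_ge:
  assumes "layered_traj h ys" "1 \<le> h" "\<not> matched \<theta> h ys"
  shows "(1 - leak) * type_lik \<theta> h 3 ys \<le> mean_lik \<theta> h ys"
proof (cases "h = 1")
  case True
  have "1 mod Suc n = 1" using n_pos by simp
  then show ?thesis using type_lik_live_block_start[OF assms(1,3)] True by (simp add: mean_lik_def)
next
  case False
  then show ?thesis using sum_type_lik[OF assms] by (simp add: mean_lik_def)
qed

text \<open>With no key shared between trajectories, their weights depend on disjoint sets of
  offsets. The average over the secrets factorizes, and each trajectory costs one factor
  \<open>1 - leak\<close>.\<close>

lemma sum_prod_traj_weight:
  assumes "\<And>\<tau>. \<tau> \<in> set hist \<Longrightarrow> \<exists>h\<in>{1..H}. layered_traj h \<tau> \<and> \<not> matched \<theta> h \<tau>"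
    and "distinct (concat (map keys hist))"
  shows "(1 - leak) ^ length hist * prod_list (map (traj_weight null_mdp) hist) * card secrets
    \<le> (\<Sum>\<sigma>\<in>secrets. prod_list (map (traj_weight (hard_mdp \<theta> \<sigma>)) hist))"
  using assms
proof (induction hist)
  case (Cons \<tau> hist)
  let ?P = "\<lambda>\<sigma>. prod_list (map (traj_weight (hard_mdp \<theta> \<sigma>)) hist)"
  obtain h where h: "1 \<le> h" "h \<le> H" "layered_traj h \<tau>" "\<not> matched \<theta> h \<tau>" using Cons.prems(1)[of \<tau>] by auto
  \<comment> \<open>The weight of the remaining history ignores the offsets met by
    \<open>\<tau>\<close>, so it can play the role of \<open>G\<close>.\<close>
  have indep: "?P (\<sigma>(k := v)) = ?P \<sigma>" if "k \<in> set (keys \<tau>)" for k \<sigma> v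
  proof -
    have "traj_weight (hard_mdp \<theta> (\<sigma>(k := v))) \<tau>' = traj_weight (hard_mdp \<theta> \<sigma>) \<tau>'" if "\<tau>' \<in> set hist" for \<tau>'
    proof -
      have "\<tau>' \<in> set (\<tau> # hist)" using that by simp
      from Cons.prems(1)[OF this] obtain h' where "1 \<le> h'" "layered_traj h' \<tau>'" by auto
      moreover have "k \<notin> set (keys \<tau>')" using Cons.prems(2) that \<open>k \<in> set (keys \<tau>)\<close> by auto
      ultimately show ?thesis by (intro traj_weight_hard_upd)
    qed
    then show ?thesis by (metis (no_types, lifting) map_cong)
  qed
  have nn: "0 \<le> prod_list (map (traj_weight M) ys)" for M :: "(nat, bool) mdp" and ys
    by (induction ys) (auto simp: traj_weight_nonneg)
  have "(1 - leak) ^ length (\<tau> # hist) * prod_list (map (traj_weight null_mdp) (\<tau> # hist)) * card secrets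
      = (1 / (4 * N)) ^ (length \<tau> - 1) * ((1 - leak) * type_lik \<theta> h 3 \<tau>) *
        ((1 - leak) ^ length hist * prod_list (map (traj_weight null_mdp) hist) * card secrets)"
    by (simp add: traj_weight_null[OF h(3), of \<theta>])
  also have "\<dots> \<le> (1 / (4 * N)) ^ (length \<tau> - 1) * mean_lik \<theta> h \<tau> * (\<Sum>\<sigma>\<in>secrets. ?P \<sigma>)"
  proof (rule mult_mono)
    show "(1 - leak) ^ length hist * prod_list (map (traj_weight null_mdp) hist) * card secrets
        \<le> (\<Sum>\<sigma>\<in>secrets. ?P \<sigma>)"
      using Cons.prems by (intro Cons.IH) auto
    have "(1 - leak) * type_lik \<theta> h 3 \<tau> \<le> mean_lik \<theta> h \<tau>" using mean_lik_ge h by blast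
    moreover have "0 \<le> (1 - leak) * type_lik \<theta> h 3 \<tau>" using leak_bounds type_lik_nonneg by simp
    ultimately show "(1 / (4 * N)) ^ (length \<tau> - 1) * ((1 - leak) * type_lik \<theta> h 3 \<tau>)
        \<le> (1 / (4 * N)) ^ (length \<tau> - 1) * mean_lik \<theta> h \<tau>"
      "0 \<le> (1 / (4 * N)) ^ (length \<tau> - 1) * mean_lik \<theta> h \<tau>"
      by (auto intro!: mult_left_mono)
    show "0 \<le> (1 - leak) ^ length hist * prod_list (map (traj_weight null_mdp) hist) * card secrets"
      using leak_bounds nn by simp
  qed
  also have "\<dots> = (\<Sum>\<sigma>\<in>secrets. traj_weight (hard_mdp \<theta> \<sigma>) \<tau> * ?P \<sigma>)"
    using h Cons.prems indep by (intro sum_traj_weight[symmetric]) auto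
  finally show ?case by simp
qed simp

end

section \<open>The null process\<close>

context lock_family
begin

definition fresh :: "(nat, bool) trajectory list \<Rightarrow> bool" where
  "fresh hist \<longleftrightarrow> distinct (concat (map keys hist))"

lemma keys_append [simp]: "keys (xs @ ys) = keys xs @ keys ys"
  by (simp add: keys_def)

lemma length_keys [simp]: "length (keys ys) = length ys"
  by (simp add: keys_def)

lemma layer_hard_mdp: "layer (hard_mdp \<theta> \<sigma>) = X" and init_hard_mdp: "init (hard_mdp \<theta> \<sigma>) = reset_dist 1"
  by (simp_all add: hard_mdp_def reset_dist_def)

lemma horizon_null_mdp [simp]: "horizon null_mdp = H"
  by (simp add: null_mdp_def)

lemma rollout_null_layered:
  "\<tau>' \<in> set_pmf (rollout null_mdp f k \<tau> x) \<Longrightarrow> lay x = h \<Longrightarrow> h + k = Suc H \<Longrightarrow>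
     \<exists>ys. \<tau>' = \<tau> @ ys \<and> layered_traj h ys"
proof (induction k arbitrary: \<tau> x h)
  case (Suc k)
  then obtain r x' where x': "x' \<in> set_pmf (transition null_mdp x (f \<tau> x))"
    and r: "\<tau>' \<in> set_pmf (rollout null_mdp f k (\<tau> @ [(x, f \<tau> x, r)]) x')" by auto
  have "lay x' = Suc h" using x' Suc.prems by (simp add: null_mdp_def mem_X)
  from Suc.IH[OF r this] Suc.prems obtain ys
    where "\<tau>' = (\<tau> @ [(x, f \<tau> x, r)]) @ ys" "layered_traj (Suc h) ys" by auto
  then show ?case using Suc.prems by (intro exI[of _ "(x, f \<tau> x, r) # ys"]) simp
qed simp

lemma interaction_null_layered:
  assumes "is_algorithm H alg"
  shows "hist \<in> set_pmf (interaction null_mdp reset_dist alg t) \<Longrightarrow> \<tau> \<in> set hist \<Longrightarrow>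
    \<exists>h\<in>{1..H}. layered_traj h \<tau>"
proof (induction t arbitrary: hist)
  case (Suc t)
  then obtain h' where h': "h' \<in> set_pmf (interaction null_mdp reset_dist alg t)"
    and r: "hist \<in> set_pmf (interaction_round null_mdp reset_dist alg h')" by auto
  show ?case
  proof (cases "alg h'")
    case (Stop \<pi>)
    then show ?thesis using Suc h' r by (simp add: interaction_round_def)
  next
    case (Reset h f)
    then have h: "h \<in> {1..H}" using assms unfolding is_algorithm_def by blast
    obtain x \<tau>' where x: "x \<in> X h" and \<tau>': "\<tau>' \<in> set_pmf (rollout null_mdp f (Suc H - h) [] x)"
      and hist: "hist = h' @ [\<tau>']"
      using r Reset by (auto simp: interaction_round_def reset_dist_def rollout_from_def)
    have "layered_traj h \<tau>'" using rollout_null_layered[OF \<tau>', of h] x h by (simp add: mem_X)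
    then show ?thesis using Suc h' hist h by auto
  qed
qed simp

lemma finite_interaction_null: "finite (set_pmf (interaction null_mdp reset_dist alg t))"
proof -
  have "finite (set_pmf (interaction_round null_mdp reset_dist alg hist))" for hist
    by (cases "alg hist")
      (auto simp: interaction_round_def reset_dist_def rollout_from_def null_mdp_def intro!: rollout_finite)
  then show ?thesis by (induction t) auto
qed

section \<open>The probability of meeting a key twice\<close>

lemma prob_key_le:
  assumes "finite A"
  shows "measure_pmf.prob (pmf_of_set (X h)) {x. x div 4 \<in> A} \<le> card A / N"
proof -
  have "X h \<inter> {x. x div 4 \<in> A} \<subseteq> (\<Union>k\<in>A. {4 * k..<4 * k + 4})" by auto
  then have "card (X h \<inter> {x. x div 4 \<in> A}) \<le> card (\<Union>k\<in>A. {4 * k..<4 * k + 4})"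
    using assms by (intro card_mono) auto
  also have "\<dots> \<le> (\<Sum>k\<in>A. card {4 * k..<4 * k + 4})" by (rule card_UN_le[OF assms])
  finally have "real (card (X h \<inter> {x. x div 4 \<in> A})) \<le> 4 * card A" by simp
  then show ?thesis using N_pos by (simp add: measure_pmf_of_set card_X field_simps)
qed

text \<open>Under the null process successors are uniform over the next layer, just like the reset
  state. Starting from a uniform draw makes the induction hypothesis fit each transition. Each of
  the \<open>k\<close> draws must avoid at most \<open>card K + length \<tau> + k\<close> keys, and
  each key has probability at most \<open>1 / N\<close>.\<close>

lemma prob_stale_rollout:
  assumes "finite K" "distinct (keys \<tau>)" "set (keys \<tau>) \<inter> K = {}"
  shows "measure_pmf.prob (bind_pmf (pmf_of_set (X h)) (rollout null_mdp f k \<tau>))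
      {t. \<not> (distinct (keys t) \<and> set (keys t) \<inter> K = {})}
    \<le> real k * (card K + length \<tau> + k) / N"
  using assms(2,3)
proof (induction k arbitrary: \<tau> h)
  case 0
  have "rollout null_mdp f 0 \<tau> = (\<lambda>_. return_pmf \<tau>)" by auto
  then show ?case using 0 by (simp add: measure_return_pmf)
next
  case (Suc k)
  let ?A = "{t. \<not> (distinct (keys t) \<and> set (keys t) \<inter> K = {})}"
  define c where "c = real k * (card K + Suc (length \<tau>) + k) / N"
  have step: "measure_pmf.prob (rollout null_mdp f (Suc k) \<tau> x) ?A \<le> c"
    if "x \<notin> {x. x div 4 \<in> K \<union> set (keys \<tau>)}" for x
  proof -
    have "measure_pmf.prob (bind_pmf (transition null_mdp x (f \<tau> x))
        (rollout null_mdp f k (\<tau> @ [(x, f \<tau> x, r)]))) ?A \<le> c" for r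
      using Suc.IH[of "\<tau> @ [(x, f \<tau> x, r)]" "Suc (lay x)"] that Suc.prems
      by (simp add: null_mdp_def c_def Int_commute)
    then have "measure_pmf.prob (rollout null_mdp f (Suc k) \<tau> x) ?A
        \<le> measure_pmf.prob (reward null_mdp x (f \<tau> x)) {} + c"
      unfolding rollout.simps by (intro prob_bind_le) (auto simp: c_def)
    then show ?thesis by simp
  qed
  have "measure_pmf.prob (bind_pmf (pmf_of_set (X h)) (rollout null_mdp f (Suc k) \<tau>)) ?A
      \<le> measure_pmf.prob (pmf_of_set (X h)) {x. x div 4 \<in> K \<union> set (keys \<tau>)} + c"
    using step by (intro prob_bind_le) (auto simp: c_def)
  also have "\<dots> \<le> real (card (K \<union> set (keys \<tau>))) / N + c"
    using assms(1) by (intro add_right_mono prob_key_le) simp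
  also have "\<dots> \<le> real (card K + length \<tau>) / N + c"
  proof -
    have "card (K \<union> set (keys \<tau>)) \<le> card K + length \<tau>"
      using card_Un_le[of K "set (keys \<tau>)"] card_length[of "keys \<tau>"] by simp
    then show ?thesis by (intro add_right_mono divide_right_mono) auto
  qed
  also have "\<dots> \<le> real (Suc k) * (card K + length \<tau> + Suc k) / N"
    using N_pos by (simp add: c_def field_simps)
  finally show ?case .
qed

lemma prob_not_fresh:
  assumes alg: "is_algorithm H alg"
  shows "measure_pmf.prob (interaction null_mdp reset_dist alg t) {hist. \<not> fresh hist} \<le> (real t * H)\<^sup>2 / N"
proof (induction t)
  case 0
  then show ?case by (simp add: measure_return_pmf fresh_def)
next
  case (Suc t)
  \<comment> \<open>One round makes at most \<open>H\<close> draws, each avoiding at most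
    \<open>t * H\<close> earlier keys and \<open>H\<close> of the present trajectory; summed over
    the rounds this gives a birthday bound.\<close>
  define c where "c = real H * (real t * H + H) / N"
  have round: "measure_pmf.prob (interaction_round null_mdp reset_dist alg hist) {hist. \<not> fresh hist} \<le> c"
    if hist: "hist \<in> set_pmf (interaction null_mdp reset_dist alg t)" and fr: "fresh hist" for hist
  proof (cases "alg hist")
    case (Stop \<pi>)
    then show ?thesis using fr by (simp add: interaction_round_def c_def measure_return_pmf)
  next
    case (Reset h f)
    then have h: "1 \<le> h" "h \<le> H" using alg by (auto simp: is_algorithm_def)
    define K where "K = set (concat (map keys hist))"
    define k where "k = Suc H - h"
    have "length (concat (map keys hist')) \<le> length hist' * H" if "set hist' \<subseteq> set hist" for hist'
      using that
    proof (induction hist')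
      case (Cons \<tau> hist')
      then obtain h' where "h' \<in> {1..H}" "layered_traj h' \<tau>"
        using interaction_null_layered[OF alg hist, of \<tau>] by auto
      then have "length \<tau> \<le> H" using layered_traj_length by fastforce
      then show ?case using Cons by simp
    qed simp
    from this[of hist] have "card K \<le> length hist * H" unfolding K_def using card_length order_trans by blast
    also have "\<dots> \<le> t * H" using interaction_length[OF hist] by simp
    finally have K: "real (card K) \<le> real t * H" by (metis of_nat_le_iff of_nat_mult)
    have "interaction_round null_mdp reset_dist alg hist
        = map_pmf (\<lambda>\<tau>. hist @ [\<tau>]) (bind_pmf (pmf_of_set (X h)) (rollout null_mdp f k []))"
      by (simp add: interaction_round_def Reset map_bind_pmf reset_dist_def rollout_from_def[abs_def] k_def)
    then have "measure_pmf.prob (interaction_round null_mdp reset_dist alg hist) {hist. \<not> fresh hist}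
        = measure_pmf.prob (bind_pmf (pmf_of_set (X h)) (rollout null_mdp f k []))
            {t. \<not> (distinct (keys t) \<and> set (keys t) \<inter> K = {})}"
      using fr by (simp add: measure_map_pmf fresh_def K_def vimage_def Int_commute)
    also have "\<dots> \<le> real k * (card K + length ([] :: (nat, bool) trajectory) + k) / N"
      by (rule prob_stale_rollout) (auto simp: K_def)
    also have "\<dots> \<le> c"
      unfolding c_def using K h by (intro divide_right_mono mult_mono) (auto simp: k_def)
    finally show ?thesis .
  qed
  have "measure_pmf.prob (interaction null_mdp reset_dist alg (Suc t)) {hist. \<not> fresh hist}
      \<le> measure_pmf.prob (interaction null_mdp reset_dist alg t) {hist. \<not> fresh hist} + c"
    unfolding interaction.simps using round by (intro prob_bind_le) (auto simp: c_def)
  also have "\<dots> \<le> (real t * H)\<^sup>2 / N + c" using Suc by simp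
  also have "\<dots> \<le> (real (Suc t) * H)\<^sup>2 / N"
    using N_pos by (simp add: c_def power2_eq_square field_simps)
  finally show ?case .
qed

section \<open>Counting the secrets that a history cannot reveal\<close>

definition fooled :: "(nat, bool) algorithm \<Rightarrow> nat set \<Rightarrow> (nat, bool) trajectory list \<Rightarrow> bool" where
  "fooled alg \<theta> hist \<longleftrightarrow> fresh hist \<and> alg hist \<noteq> Stop (pol \<theta>) \<and>
     (\<forall>\<tau>\<in>set hist. \<not> matched \<theta> (lay (fst (hd \<tau>))) \<tau>)"

text \<open>The output is right for at most one secret, and the actions of a trajectory in a given
  block spell out at most one secret. A fresh history thus fools all but \<open>1 + T * m\<close>
  secrets.\<close>

lemma card_fooled:
  assumes "fresh hist" "length hist \<le> T"
  shows "2 ^ n \<le> card {\<theta> \<in> Pow {1..n}. fooled alg \<theta> hist} + 1 + T * m"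
proof -
  define F where "F = {\<theta> \<in> Pow {1..n}. fooled alg \<theta> hist}"
  define A where "A = {\<theta> \<in> Pow {1..n}. alg hist = Stop (pol \<theta>)}"
  define B where "B = (\<lambda>\<tau> :: (nat, bool) trajectory. \<lambda>b. {\<theta> \<in> Pow {1..n}.
     \<forall>j\<in>{1..n}. fst (snd (\<tau> ! (b * Suc n + j - lay (fst (hd \<tau>))))) = (j \<in> \<theta>)})"
  have fin: "finite F" "finite A" "finite (\<Union>\<tau>\<in>set hist. \<Union>b<m. B \<tau> b)"
    by (auto simp: F_def A_def B_def)
  have "Pow {1..n} \<subseteq> (F \<union> A) \<union> (\<Union>\<tau>\<in>set hist. \<Union>b<m. B \<tau> b)"
    using assms(1) by (auto simp: F_def A_def B_def fooled_def matched_def)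
  then have "card (Pow {1..n}) \<le> card ((F \<union> A) \<union> (\<Union>\<tau>\<in>set hist. \<Union>b<m. B \<tau> b))"
    using fin by (intro card_mono) auto
  also have "\<dots> \<le> card (F \<union> A) + card (\<Union>\<tau>\<in>set hist. \<Union>b<m. B \<tau> b)" by (rule card_Un_le)
  also have "\<dots> \<le> card F + card A + card (\<Union>\<tau>\<in>set hist. \<Union>b<m. B \<tau> b)"
    using card_Un_le[of F A] by simp
  also have "card A \<le> 1"
  proof -
    have "\<forall>\<theta>\<in>A. \<forall>\<theta>'\<in>A. \<theta> = \<theta>'" using inj_pol by (auto simp: A_def inj_on_def)
    then show ?thesis using card_le_Suc0_iff_eq[OF fin(2)] by simp
  qed
  also have "card (\<Union>\<tau>\<in>set hist. \<Union>b<m. B \<tau> b) \<le> T * m"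
  proof -
    have B: "card (B \<tau> b) \<le> 1" for \<tau> b
    proof -
      have "finite (B \<tau> b)" by (simp add: B_def)
      moreover have "\<forall>\<theta>\<in>B \<tau> b. \<forall>\<theta>'\<in>B \<tau> b. \<theta> = \<theta>'" unfolding B_def by blast
      ultimately show ?thesis using card_le_Suc0_iff_eq by fastforce
    qed
    have "card (\<Union>b<m. B \<tau> b) \<le> m" for \<tau>
      using card_UN_le[of "{..<m}" "B \<tau>"] sum_mono[of "{..<m}" "\<lambda>b. card (B \<tau> b)" "\<lambda>_. 1"] B by simp
    then have "(\<Sum>\<tau>\<in>set hist. card (\<Union>b<m. B \<tau> b)) \<le> (\<Sum>\<tau>\<in>set hist. m)" by (intro sum_mono)
    then have "card (\<Union>\<tau>\<in>set hist. \<Union>b<m. B \<tau> b) \<le> card (set hist) * m"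
      using card_UN_le[of "set hist" "\<lambda>\<tau>. \<Union>b<m. B \<tau> b"] by simp
    also have "\<dots> \<le> T * m" using card_length[of hist] assms(2) by simp
    finally show ?thesis .
  qed
  finally show ?thesis by (simp add: F_def card_Pow)
qed

lemma prod_traj_weight_nonneg: "0 \<le> prod_list (map (traj_weight M) hist)"
  by (induction hist) (auto simp: traj_weight_nonneg)

text \<open>For each secret, fooled histories are failures and have probability at most
  \<open>1 - p\<close> under every hard MDP. Averaging over the offsets carries this bound to the
  null process at the cost of \<open>(1 - leak) ^ T\<close>. There the histories have one law for
  all secrets, so summing over the secrets and counting per history gives the claim.\<close>

lemma success_bound:
  assumes alg: "is_algorithm H alg" "proper Pol alg"
    and stop: "\<And>\<theta> \<sigma> hist. \<theta> \<subseteq> {1..n} \<Longrightarrow>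
      hist \<in> set_pmf (interaction (hard_mdp \<theta> \<sigma>) reset_dist alg T) \<Longrightarrow> length hist < T"
    and succ: "\<And>\<theta> \<sigma>. \<theta> \<subseteq> {1..n} \<Longrightarrow>
      p \<le> return_prob (hard_mdp \<theta> \<sigma>) reset_dist alg {\<pi>. eps_optimal Pol (hard_mdp \<theta> \<sigma>) (1 / 8) \<pi>}"
  shows "(1 - leak) ^ T * (1 - (1 + real T * m) / 2 ^ n - (real T * H)\<^sup>2 / N) \<le> 1 - p"
proof -
  define P where "P = (\<lambda>\<theta> \<sigma>. interaction (hard_mdp \<theta> \<sigma>) reset_dist alg T)"
  define P0 where "P0 = interaction null_mdp reset_dist alg T"
  define S where "S = set_pmf P0"
  have finS: "finite S" by (simp add: S_def P0_def finite_interaction_null)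
  have len: "length hist \<le> T" if "hist \<in> S" for hist
    using interaction_length[of hist null_mdp reset_dist alg T] that by (simp add: S_def P0_def)
  \<comment> \<open>A fooled history does not end with \<open>pol \<theta>\<close>, the only
    acceptable output; every run has stopped by round \<open>T\<close>, so success is decided
    there.\<close>
  have fail: "(\<Sum>hist | hist \<in> S \<and> fooled alg \<theta> hist. pmf (P \<theta> \<sigma>) hist) \<le> 1 - p"
    if \<theta>: "\<theta> \<subseteq> {1..n}" for \<theta> \<sigma>
  proof -
    let ?G = "{\<pi>. eps_optimal Pol (hard_mdp \<theta> \<sigma>) (1 / 8) \<pi>}"
    let ?W = "{hist. \<exists>\<pi>\<in>?G. alg hist = Stop \<pi>}"
    let ?F = "{hist. hist \<in> S \<and> fooled alg \<theta> hist}"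
    have disj: "?W \<inter> ?F = {}"
    proof -
      have "\<pi> = pol \<theta>" if "alg hist = Stop \<pi>" "\<pi> \<in> ?G" for hist \<pi>
        using that alg(2) \<theta> by (intro eps_optimal_imp_eq[of \<theta> \<pi> \<sigma>]) (auto simp: proper_def)
      then show ?thesis by (auto simp: fooled_def)
    qed
    have "p \<le> success_prob (hard_mdp \<theta> \<sigma>) reset_dist alg ?G T"
      using succ[OF \<theta>, of \<sigma>] return_prob_le_success[of "hard_mdp \<theta> \<sigma>" reset_dist alg T ?G] stop[OF \<theta>, of _ \<sigma>]
      by (meson order_trans)
    then have "p + measure_pmf.prob (P \<theta> \<sigma>) ?F \<le> measure_pmf.prob (P \<theta> \<sigma>) ?W + measure_pmf.prob (P \<theta> \<sigma>) ?F"
      by (simp add: success_prob_def P_def)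
    also have "\<dots> = measure_pmf.prob (P \<theta> \<sigma>) (?W \<union> ?F)"
      using disj by (subst measure_pmf.finite_measure_Union) auto
    also have "\<dots> \<le> 1" by (rule measure_pmf.prob_le_1)
    also have "measure_pmf.prob (P \<theta> \<sigma>) ?F = (\<Sum>hist\<in>?F. pmf (P \<theta> \<sigma>) hist)"
      using finS by (intro measure_measure_pmf_finite) simp
    finally show ?thesis by simp
  qed
  \<comment> \<open>The coefficient \<open>\<kappa>\<close> is common to all MDPs of this horizon,
    so only the trajectory weights have to be compared.\<close>
  have avg: "(1 - leak) ^ T * pmf P0 hist * card secrets \<le> (\<Sum>\<sigma>\<in>secrets. pmf (P \<theta> \<sigma>) hist)"
    if hist: "hist \<in> S" and fool: "fooled alg \<theta> hist" for \<theta> hist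
  proof -
    obtain \<kappa> where \<kappa>: "0 \<le> \<kappa>" "\<And>M :: (nat, bool) mdp. horizon M = H \<Longrightarrow>
        pmf (interaction M reset_dist alg T) hist = \<kappa> * prod_list (map (traj_weight M) hist)"
      using pmf_interaction[OF alg(1), of reset_dist T hist] by auto
    have lay: "\<exists>h\<in>{1..H}. layered_traj h \<tau> \<and> \<not> matched \<theta> h \<tau>" if \<tau>: "\<tau> \<in> set hist" for \<tau>
    proof -
      obtain h where h: "h \<in> {1..H}" "layered_traj h \<tau>"
        using interaction_null_layered[OF alg(1), of hist T \<tau>] hist \<tau> by (auto simp: S_def P0_def)
      then have "lay (fst (hd \<tau>)) = h" using layered_traj_ne[OF h(2)] by auto
      then show ?thesis using h fool \<tau> by (auto simp: fooled_def)
    qed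
    have "(1 - leak) ^ T * pmf P0 hist * card secrets
        = (1 - leak) ^ T * (\<kappa> * prod_list (map (traj_weight null_mdp) hist) * card secrets)"
      by (simp add: P0_def \<kappa>)
    also have "\<dots> \<le> (1 - leak) ^ length hist * (\<kappa> * prod_list (map (traj_weight null_mdp) hist) * card secrets)"
      using leak_bounds len[OF hist] \<kappa>(1)
      by (intro mult_right_mono power_decreasing mult_nonneg_nonneg prod_traj_weight_nonneg) auto
    also have "\<dots> = \<kappa> * ((1 - leak) ^ length hist * prod_list (map (traj_weight null_mdp) hist) * card secrets)"
      by simp
    also have "\<dots> \<le> \<kappa> * (\<Sum>\<sigma>\<in>secrets. prod_list (map (traj_weight (hard_mdp \<theta> \<sigma>)) hist))"
      using \<kappa>(1) lay fool by (intro mult_left_mono sum_prod_traj_weight) (auto simp: fooled_def fresh_def)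
    also have "\<dots> = (\<Sum>\<sigma>\<in>secrets. pmf (P \<theta> \<sigma>) hist)"
      by (simp add: P_def \<kappa> sum_distrib_left)
    finally show ?thesis .
  qed
  have each: "(1 - leak) ^ T * (\<Sum>hist | hist \<in> S \<and> fooled alg \<theta> hist. pmf P0 hist) \<le> 1 - p"
    if \<theta>: "\<theta> \<in> Pow {1..n}" for \<theta>
  proof -
    let ?F = "{hist. hist \<in> S \<and> fooled alg \<theta> hist}"
    have "(1 - leak) ^ T * (\<Sum>hist\<in>?F. pmf P0 hist) * card secrets
        = (\<Sum>hist\<in>?F. (1 - leak) ^ T * pmf P0 hist * card secrets)"
      by (simp add: sum_distrib_left sum_distrib_right)
    also have "\<dots> \<le> (\<Sum>hist\<in>?F. \<Sum>\<sigma>\<in>secrets. pmf (P \<theta> \<sigma>) hist)"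
      using avg by (intro sum_mono) auto
    also have "\<dots> = (\<Sum>\<sigma>\<in>secrets. \<Sum>hist\<in>?F. pmf (P \<theta> \<sigma>) hist)" by (rule sum.swap)
    also have "\<dots> \<le> (\<Sum>\<sigma>\<in>secrets. 1 - p)" using fail \<theta> by (intro sum_mono) auto
    finally have "(1 - leak) ^ T * (\<Sum>hist\<in>?F. pmf P0 hist) * card secrets \<le> (1 - p) * card secrets"
      by (simp add: mult.commute)
    then show ?thesis using card_secrets_pos by (simp add: mult_le_cancel_right)
  qed
  \<comment> \<open>For a stale history the left-hand side is negative, which makes the bound valid
    for all of \<open>S\<close>.\<close>
  have count: "2 ^ n - (1 + real T * m) - 2 ^ n * of_bool (\<not> fresh hist)
      \<le> card {\<theta> \<in> Pow {1..n}. fooled alg \<theta> hist}" if "hist \<in> S" for hist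
  proof (cases "fresh hist")
    case True
    have "real (2 ^ n) \<le> real (card {\<theta> \<in> Pow {1..n}. fooled alg \<theta> hist} + 1 + T * m)"
      using card_fooled[OF True len[OF that]] by (intro of_nat_mono)
    then show ?thesis using True by simp
  next
    case False
    have "0 \<le> real T * m" by simp
    then show ?thesis using False by (simp add: add_increasing2 order_trans[of _ 0])
  qed
  have mass: "(\<Sum>hist\<in>S. pmf P0 hist) = 1"
    using finS by (simp add: S_def sum_pmf_eq_1)
  have stale: "(\<Sum>hist\<in>S. pmf P0 hist * of_bool (\<not> fresh hist)) \<le> (real T * H)\<^sup>2 / N"
  proof -
    have "(\<Sum>hist\<in>S. pmf P0 hist * of_bool (\<not> fresh hist)) = (\<Sum>hist\<in>S \<inter> {hist. \<not> fresh hist}. pmf P0 hist)"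
      using finS by (simp add: of_bool_def if_distrib sum.inter_restrict cong: if_cong)
    also have "\<dots> = measure_pmf.prob P0 (S \<inter> {hist. \<not> fresh hist})"
      using finS by (intro measure_measure_pmf_finite[symmetric]) simp
    also have "\<dots> \<le> measure_pmf.prob P0 {hist. \<not> fresh hist}"
      by (intro measure_pmf.finite_measure_mono) auto
    also have "\<dots> \<le> (real T * H)\<^sup>2 / N" unfolding P0_def by (rule prob_not_fresh[OF alg(1)])
    finally show ?thesis .
  qed
  have "2 ^ n * (1 - (1 + real T * m) / 2 ^ n - (real T * H)\<^sup>2 / N)
      = 2 ^ n - (1 + real T * m) - 2 ^ n * ((real T * H)\<^sup>2 / N)"
    by (simp add: right_diff_distrib)
  also have "\<dots> \<le> 2 ^ n - (1 + real T * m) - 2 ^ n * (\<Sum>hist\<in>S. pmf P0 hist * of_bool (\<not> fresh hist))"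
    by (intro diff_left_mono mult_left_mono stale) simp
  also have "\<dots> = (\<Sum>hist\<in>S. pmf P0 hist * (2 ^ n - (1 + real T * m) - 2 ^ n * of_bool (\<not> fresh hist)))"
  proof -
    have "(\<Sum>hist\<in>S. pmf P0 hist * (2 ^ n - (1 + real T * m) - 2 ^ n * of_bool (\<not> fresh hist)))
        = (\<Sum>hist\<in>S. pmf P0 hist * (2 ^ n - (1 + real T * m))
            - 2 ^ n * (pmf P0 hist * of_bool (\<not> fresh hist)))"
      by (intro sum.cong) (auto simp: algebra_simps)
    also have "\<dots> = (\<Sum>hist\<in>S. pmf P0 hist) * (2 ^ n - (1 + real T * m))
        - 2 ^ n * (\<Sum>hist\<in>S. pmf P0 hist * of_bool (\<not> fresh hist))"
      by (simp only: sum_subtractf sum_distrib_left sum_distrib_right)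
    finally show ?thesis using mass by simp
  qed
  also have "\<dots> \<le> (\<Sum>hist\<in>S. pmf P0 hist * card {\<theta> \<in> Pow {1..n}. fooled alg \<theta> hist})"
    using count by (intro sum_mono mult_left_mono) auto
  \<comment> \<open>Double counting of the pairs of a history and a secret that it fools.\<close>
  also have "\<dots> = (\<Sum>hist\<in>S. \<Sum>\<theta>\<in>Pow {1..n}. pmf P0 hist * of_bool (fooled alg \<theta> hist))"
    by (simp add: sum_distrib_left[symmetric] of_bool_def sum.If_cases Int_def)
  also have "\<dots> = (\<Sum>\<theta>\<in>Pow {1..n}. \<Sum>hist\<in>S. pmf P0 hist * of_bool (fooled alg \<theta> hist))"
    by (rule sum.swap)
  also have "\<dots> = (\<Sum>\<theta>\<in>Pow {1..n}. \<Sum>hist | hist \<in> S \<and> fooled alg \<theta> hist. pmf P0 hist)"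
    by (rule sum.cong[OF refl], subst sum.inter_filter[OF finS], rule sum.cong[OF refl]) simp
  finally have lower: "2 ^ n * (1 - (1 + real T * m) / 2 ^ n - (real T * H)\<^sup>2 / N)
      \<le> (\<Sum>\<theta>\<in>Pow {1..n}. \<Sum>hist | hist \<in> S \<and> fooled alg \<theta> hist. pmf P0 hist)" .
  have "(1 - leak) ^ T * (2 ^ n * (1 - (1 + real T * m) / 2 ^ n - (real T * H)\<^sup>2 / N))
      \<le> (1 - leak) ^ T * (\<Sum>\<theta>\<in>Pow {1..n}. \<Sum>hist | hist \<in> S \<and> fooled alg \<theta> hist. pmf P0 hist)"
    using lower leak_bounds by (intro mult_left_mono) auto
  also have "\<dots> \<le> (\<Sum>\<theta>\<in>Pow {1..n}. 1 - p)"
    by (subst sum_distrib_left) (intro sum_mono each)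
  also have "\<dots> = 2 ^ n * (1 - p)" by (simp add: card_Pow)
  finally have "2 ^ n * ((1 - leak) ^ T * (1 - (1 + real T * m) / 2 ^ n - (real T * H)\<^sup>2 / N)) \<le> 2 ^ n * (1 - p)"
    by (simp only: mult.left_commute)
  then show ?thesis by (simp only: mult_le_cancel_left) simp
qed

end

section \<open>The lower bound\<close>

text \<open>The summands bound the loss through leaks, through guessed secrets and through repeated
  keys. With about \<open>2 powr (n / 4)\<close> trajectories even the squared term is of order
  \<open>2 powr (n / 2)\<close> up to polynomial factors, against \<open>2 ^ n\<close>.\<close>

lemma error_terms_vanish:
  fixes p :: real
  assumes "0 < p"
  shows "eventually (\<lambda>n::nat. 3 / 2 * (2 * 2 powr ((real n + 1) / 4)) / 2 ^ n
    + (1 + 2 * 2 powr ((real n + 1) / 4) * real n) / 2 ^ n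
    + (2 * 2 powr ((real n + 1) / 4) * (real n + 1)\<^sup>2)\<^sup>2 / 2 ^ n < p) sequentially"
proof -
  have "(\<lambda>n::nat. 3 / 2 * (2 * 2 powr ((real n + 1) / 4)) / 2 ^ n
    + (1 + 2 * 2 powr ((real n + 1) / 4) * real n) / 2 ^ n
    + (2 * 2 powr ((real n + 1) / 4) * (real n + 1)\<^sup>2)\<^sup>2 / 2 ^ n) \<longlonglongrightarrow> 0"
    by real_asymp
  then show ?thesis using assms by (rule order_tendstoD)
qed

theorem theorem3:
  shows "\<forall>p::real. 0 < p \<and> p < 1 \<longrightarrow>
    (\<exists>(c::real) (C::real) (H\<^sub>0::nat). c > 0 \<and> C > 0 \<and>
      (\<forall>H\<ge>H\<^sub>0.
        \<exists>(X :: nat \<Rightarrow> nat set) (Pol :: (nat \<Rightarrow> bool) set)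
          (\<M> :: (nat, bool) mdp set) (\<mu> :: nat \<Rightarrow> nat pmf).
          layered H X \<and>
          real (card (total_states H X)) \<le> 2 powr (C * sqrt (real H)) \<and>
          Pol \<subseteq> policies H X \<and>
          card Pol = 2 ^ nat \<lfloor>sqrt (real H)\<rfloor> \<and>
          is_reset_dist H X \<mu> \<and>
          (\<forall>M\<in>\<M>. is_mdp M \<and> layer M = X \<and> horizon M = H \<and> \<mu> 1 = init M \<and>
             realizable Pol M \<and> C_push \<mu> M \<le> 8) \<and>
          (\<forall>alg :: (nat, bool) algorithm.
             is_algorithm H alg \<and> proper Pol alg \<and>
             (\<forall>M\<in>\<M>. return_prob M \<mu> alg {\<pi>. eps_optimal Pol M (1/8) \<pi>} \<ge> p) \<longrightarrow>
             (\<exists>M\<in>\<M>. num_trajectories M \<mu> alg \<ge> ereal (2 powr (c * sqrt (real H)))))))"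
proof (intro allI impI)
  fix p :: real assume p: "0 < p \<and> p < 1"
  obtain n0 where n0: "\<And>n. n0 \<le> n \<Longrightarrow> 3 / 2 * (2 * 2 powr ((real n + 1) / 4)) / 2 ^ n
      + (1 + 2 * 2 powr ((real n + 1) / 4) * real n) / 2 ^ n
      + (2 * 2 powr ((real n + 1) / 4) * (real n + 1)\<^sup>2)\<^sup>2 / 2 ^ n < p"
    using error_terms_vanish p unfolding eventually_sequentially by blast
  show "\<exists>(c::real) (C::real) (H\<^sub>0::nat). c > 0 \<and> C > 0 \<and>
      (\<forall>H\<ge>H\<^sub>0.
        \<exists>(X :: nat \<Rightarrow> nat set) (Pol :: (nat \<Rightarrow> bool) set)
          (\<M> :: (nat, bool) mdp set) (\<mu> :: nat \<Rightarrow> nat pmf).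
          layered H X \<and>
          real (card (total_states H X)) \<le> 2 powr (C * sqrt (real H)) \<and>
          Pol \<subseteq> policies H X \<and>
          card Pol = 2 ^ nat \<lfloor>sqrt (real H)\<rfloor> \<and>
          is_reset_dist H X \<mu> \<and>
          (\<forall>M\<in>\<M>. is_mdp M \<and> layer M = X \<and> horizon M = H \<and> \<mu> 1 = init M \<and>
             realizable Pol M \<and> C_push \<mu> M \<le> 8) \<and>
          (\<forall>alg :: (nat, bool) algorithm.
             is_algorithm H alg \<and> proper Pol alg \<and>
             (\<forall>M\<in>\<M>. return_prob M \<mu> alg {\<pi>. eps_optimal Pol M (1/8) \<pi>} \<ge> p) \<longrightarrow>
             (\<exists>M\<in>\<M>. num_trajectories M \<mu> alg \<ge> ereal (2 powr (c * sqrt (real H))))))"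
  \<comment> \<open>The exponent \<open>1 / 4\<close> keeps the squared number of trajectories small
    against \<open>2 ^ n\<close>; 5 comes from the count of states. \<open>H\<close> is large enough
    to give \<open>n \<ge> n0\<close> and at least one block.\<close>
  proof (rule exI[of _ "1 / 4"], rule exI[of _ 5], rule exI[of _ "(max n0 2)\<^sup>2"], intro conjI allI impI)
    fix H :: nat assume H: "(max n0 2)\<^sup>2 \<le> H"
    define s where "s = sqrt (real H)"
    define n where "n = nat \<lfloor>s\<rfloor>"
    have "real (max n0 2) \<le> s"
      unfolding s_def using H by (intro real_le_rsqrt) (metis of_nat_le_iff of_nat_power)
    then have "int (max n0 2) \<le> \<lfloor>s\<rfloor>" by (simp add: le_floor_iff)
    then have n: "n0 \<le> n" "2 \<le> n" by (auto simp: n_def)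
    have s: "real n \<le> s" "s < real n + 1" "0 \<le> s" by (auto simp: n_def s_def)
    have Hs: "real H = s\<^sup>2" by (simp add: s_def)
    have "real (n\<^sup>2) \<le> real H" unfolding Hs using s by (simp add: power_mono)
    then have nH: "n\<^sup>2 \<le> H" by (simp only: of_nat_le_iff)
    have Hn: "real H \<le> (real n + 1)\<^sup>2" unfolding Hs using s by (intro power_mono) auto
    \<comment> \<open>The blocks fill \<open>(n - 1) * (n + 1) = n\<^sup>2 - 1\<close> layers, which
      leaves at least one layer for the final payment.\<close>
    define m where "m = n - 1"
    define N where "N = (2::nat) ^ n"
    have "m * Suc n < n\<^sup>2"
    proof -
      obtain k where "n = Suc k" using n by (cases n) auto
      then show ?thesis by (simp add: m_def power2_eq_square)
    qed
    then interpret lock_family n m N H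
      using n nH by unfold_locales (auto simp: m_def N_def)
    let ?\<M> = "{hard_mdp \<theta> \<sigma> | \<theta> \<sigma>. \<theta> \<subseteq> {1..n}}"
    have card: "real (card (total_states H X)) \<le> 2 powr (5 * s)"
    proof -
      have "card (total_states H X) \<le> (\<Sum>h\<in>{1..H}. card (X h))"
        unfolding total_states_def by (rule card_UN_le) simp
      then have "real (card (total_states H X)) \<le> real (H * (4 * N))"
        by (subst of_nat_le_iff) (simp add: card_X)
      also have "\<dots> = s\<^sup>2 * (4 * 2 ^ n)" using Hs by (simp add: N_def)
      \<comment> \<open>Uses \<open>s \<le> 2 powr s\<close> twice,
        \<open>4 \<le> 2 powr (2 * s)\<close> and \<open>n \<le> s\<close>; the exponents add up to
        \<open>5 * s\<close>.\<close>
      also have "\<dots> \<le> (2 powr s)\<^sup>2 * (2 powr (2 * s) * 2 powr s)"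
      proof (intro mult_mono power_mono)
        have "s < real (2 ^ n)" if "s < real n + 1"
        proof -
          have "n + 1 \<le> 2 ^ n" using Suc_leI[OF less_exp[of n]] by simp
          then have "real (n + 1) \<le> real (2 ^ n)" by (rule of_nat_mono)
          then show ?thesis using that by simp
        qed
        moreover have "real (2 ^ n) = 2 powr n" by (simp add: powr_realpow)
        moreover have p2: "2 powr real n \<le> 2 powr s" using s by (intro powr_mono) auto
        ultimately show "s \<le> 2 powr s" using s by linarith
        show "(2::real) ^ n \<le> 2 powr s" using p2 by (simp add: powr_realpow)
        have "(2::real) powr 2 \<le> 2 powr (2 * s)" using s n by (intro powr_mono) auto
        then show "4 \<le> 2 powr (2 * s)" by simp
      qed (use s in auto)
      also have "\<dots> = 2 powr (5 * s)"
        by (simp add: power2_eq_square powr_add[symmetric])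
      finally show ?thesis .
    qed
    have lower: "\<exists>M\<in>?\<M>. num_trajectories M reset_dist alg \<ge> ereal (2 powr (1 / 4 * s))"
      if alg: "is_algorithm H alg" "proper Pol alg"
        and succ: "\<forall>M\<in>?\<M>. return_prob M reset_dist alg {\<pi>. eps_optimal Pol M (1/8) \<pi>} \<ge> p" for alg
    proof (rule ccontr)
      assume neg: "\<not> ?thesis"
      have few: "num_trajectories (hard_mdp \<theta> \<sigma>) reset_dist alg < ereal (2 powr (1 / 4 * s))"
        if \<theta>: "\<theta> \<subseteq> {1..n}" for \<theta> \<sigma>
      proof -
        have "hard_mdp \<theta> \<sigma> \<in> ?\<M>" using \<theta> by blast
        then have "\<not> ereal (2 powr (1 / 4 * s)) \<le> num_trajectories (hard_mdp \<theta> \<sigma>) reset_dist alg"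
          using neg by blast
        then show ?thesis by (simp only: not_le)
      qed
      \<comment> \<open>Rounding up makes every history with fewer than
        \<open>2 powr (s / 4)\<close> trajectories shorter than \<open>T\<close>. \<open>B\<close>
        bounds \<open>T\<close> in terms of \<open>n\<close> alone; its factor 2 absorbs the
        rounding.\<close>
      define T where "T = nat \<lceil>2 powr (1 / 4 * s)\<rceil>"
      define B where "B = 2 * 2 powr ((real n + 1) / 4)"
      have T: "2 powr (1 / 4 * s) \<le> real T" by (simp add: T_def)
      have TB: "real T \<le> B"
      proof -
        have "real T \<le> 2 powr (1 / 4 * s) + 1" unfolding T_def by simp
        moreover have "(1::real) \<le> 2 powr (1 / 4 * s)" using s by (intro ge_one_powr_ge_zero) auto
        moreover have "2 powr (1 / 4 * s) \<le> 2 powr ((real n + 1) / 4)" using s by (intro powr_mono) auto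
        ultimately show ?thesis unfolding B_def by linarith
      qed
      have bound: "(1 - leak) ^ T * (1 - (1 + real T * m) / 2 ^ n - (real T * H)\<^sup>2 / N) \<le> 1 - p"
      proof (rule success_bound[OF alg])
        fix \<theta> \<sigma> hist assume \<theta>: "\<theta> \<subseteq> {1..n}"
          and "hist \<in> set_pmf (interaction (hard_mdp \<theta> \<sigma>) reset_dist alg T)"
        then have "real (length hist) < 2 powr (1 / 4 * s)"
          using length_less_of_num_trajectories[OF few] by blast
        then show "length hist < T" using T by linarith
      qed (use succ in blast)
      define u where "u = leak * T"
      define v where "v = (1 + real T * m) / 2 ^ n + (real T * H)\<^sup>2 / N"
      have v: "v \<le> (1 + B * real n) / 2 ^ n + (B * (real n + 1)\<^sup>2)\<^sup>2 / 2 ^ n"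
      proof -
        have "real T * m \<le> B * real n" using TB by (intro mult_mono) (auto simp: m_def B_def)
        moreover have "(real T * H)\<^sup>2 \<le> (B * (real n + 1)\<^sup>2)\<^sup>2"
          using TB Hn by (intro power_mono mult_mono) (auto simp: B_def)
        moreover have "real N = 2 ^ n" by (simp add: N_def)
        ultimately show ?thesis unfolding v_def
          by (simp only:) (intro add_mono divide_right_mono, auto)
      qed
      have u: "u \<le> 3 / 2 * B / 2 ^ n"
      proof -
        have "n = Suc m" using n by (simp add: m_def)
        then have "leak = 3 / 2 / 2 ^ n" by (simp add: leak_def power_one_over)
        then show ?thesis unfolding u_def using TB by (simp add: divide_right_mono)
      qed
      have uv: "u + v < p" using u v n0[OF n(1)] by (simp add: B_def)
      have uv0: "0 \<le> u" "0 \<le> v" using leak_bounds by (auto simp: u_def v_def)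
      \<comment> \<open>By Bernoulli, \<open>bound\<close> implies
        \<open>(1 - u) * (1 - v) \<le> 1 - p\<close>, hence \<open>p \<le> u + v\<close>, against
        \<open>uv\<close>.\<close>
      have "1 - u \<le> (1 - leak) ^ T"
        using Bernoulli_inequality[of "- leak" T] leak_bounds by (simp add: u_def mult.commute)
      then have "(1 - u) * (1 - v) \<le> (1 - leak) ^ T * (1 - v)"
        using uv uv0 p by (intro mult_right_mono) auto
      also have "\<dots> \<le> 1 - p" using bound by (simp only: v_def diff_diff_eq)
      finally have "u * v + (p - u - v) \<le> 0" by (simp add: algebra_simps)
      then show False using uv uv0 mult_nonneg_nonneg[OF uv0] by linarith
    qed
    show "\<exists>(X :: nat \<Rightarrow> nat set) (Pol :: (nat \<Rightarrow> bool) set)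
          (\<M> :: (nat, bool) mdp set) (\<mu> :: nat \<Rightarrow> nat pmf).
          layered H X \<and>
          real (card (total_states H X)) \<le> 2 powr (5 * sqrt (real H)) \<and>
          Pol \<subseteq> policies H X \<and>
          card Pol = 2 ^ nat \<lfloor>sqrt (real H)\<rfloor> \<and>
          is_reset_dist H X \<mu> \<and>
          (\<forall>M\<in>\<M>. is_mdp M \<and> layer M = X \<and> horizon M = H \<and> \<mu> 1 = init M \<and>
             realizable Pol M \<and> C_push \<mu> M \<le> 8) \<and>
          (\<forall>alg :: (nat, bool) algorithm.
             is_algorithm H alg \<and> proper Pol alg \<and>
             (\<forall>M\<in>\<M>. return_prob M \<mu> alg {\<pi>. eps_optimal Pol M (1/8) \<pi>} \<ge> p) \<longrightarrow>
             (\<exists>M\<in>\<M>. num_trajectories M \<mu> alg \<ge> ereal (2 powr (1 / 4 * sqrt (real H)))))"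
    proof (rule exI[of _ X], rule exI[of _ Pol], rule exI[of _ ?\<M>], rule exI[of _ reset_dist], intro conjI)
      show "layered H X" by (rule layered_X)
      show "real (card (total_states H X)) \<le> 2 powr (5 * sqrt (real H))" using card by (simp add: s_def)
      show "Pol \<subseteq> policies H X" by (rule Pol_subset)
      show "card Pol = 2 ^ nat \<lfloor>sqrt (real H)\<rfloor>" using card_Pol by (simp add: n_def s_def)
      show "is_reset_dist H X reset_dist" by (simp add: is_reset_dist_def reset_dist_def)
      show "\<forall>M\<in>?\<M>. is_mdp M \<and> layer M = X \<and> horizon M = H \<and> reset_dist 1 = init M \<and>
             realizable Pol M \<and> C_push reset_dist M \<le> 8"
        using is_mdp_hard_mdp realizable_hard_mdp C_push_hard_mdp
        by (auto simp: layer_hard_mdp init_hard_mdp)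
      show "\<forall>alg :: (nat, bool) algorithm.
             is_algorithm H alg \<and> proper Pol alg \<and>
             (\<forall>M\<in>?\<M>. return_prob M reset_dist alg {\<pi>. eps_optimal Pol M (1/8) \<pi>} \<ge> p) \<longrightarrow>
             (\<exists>M\<in>?\<M>. num_trajectories M reset_dist alg \<ge> ereal (2 powr (1 / 4 * sqrt (real H))))"
        using lower unfolding s_def by blast
    qed
  qed simp_all
qed

end
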